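(* Let $d\ge 1$, $m_0,m_1\in\mathbb R^d$, $\Sigma_0,\Sigma_1\in\mathbb S_{++}^d$, $a,b>0$, $\tau_0,\tau_1>0$, and let $\mu_0=\mathcal N(m_0,\Sigma_0)$, $\mu_1=\mathcal N(m_1,\Sigma_1)$, $\alpha=a\mu_0$, $\beta=b\mu_1$. Let $\gamma_*=M_*\pi_*$ be the measure on $\mathbb R^d\times\mathbb R^d$ defined in the context. Then $\gamma_*$ satisfies the KL-unbalanced complementary-slackness conditions: there exist measurable functions $\phi,\psi:\mathbb R^d\to\mathbb R$ such that $$\phi(x)+\psi(y)\le\|x-y\|^2\quad\text{for all }x,y\in\mathbb R^d,$$ $$(\gamma_* )_0=e^{-\phi/\tau_0}\alpha,\qquad(\gamma_* )_1=e^{-\psi/\tau_1}\beta,$$ $$\phi(x)+\psi(y)=\|x-y\|^2\quad\text{for }\gamma_*\text{-almost every }(x,y).$$ Consequently, the minimizer of the problem $$\inf_{\gamma\in\mathcal M_+(\mathbb R^d\times\mathbb R^d)}\left\{\int\|x-y\|^2\,\mathrm d\gamma(x,y)+\tau_0\,\mathrm{KL}(\gamma_0\mid\alpha)+\tau_1\,\mathrm{KL}(\gamma_1\mid\beta)\right\}$$ is unique.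
   Context: $\mathbb S_{++}^d$ is the cone of real symmetric positive definite $d\times d$ matrices and $I$ is the $d\times d$ identity matrix. $\mathcal N(m,\Sigma)$ is the Gaussian probability measure with mean $m$ and covariance $\Sigma$. $\mathcal M_+(E)$ is the cone of finite non-negative Borel measures on $E$. For $\gamma\in\mathcal M_+(\mathbb R^d\times\mathbb R^d)$, $\gamma_0$ and $\gamma_1$ denote its first and second marginals. $W_2$ is the quadratic Wasserstein distance on Borel probability measures on $\mathbb R^d$ with finite second moment (cost $\|x-y\|^2$). For finite non-negative measures $\rho,\eta$ the generalized Kullback--Leibler divergence is $\mathrm{KL}(\rho\mid\eta)=\int(r\log r-r+1)\,\mathrm d\eta$ if $\rho\ll\eta$ with $r=\mathrm d\rho/\mathrm d\eta$, and $\mathrm{KL}(\rho\mid\eta)=+\infty$ if $\rho\not\ll\eta$. Definitions (all matrix square roots are principal square roots): $r_0=2/\tau_0$, $r_1=2/\tau_1$, $A_0=\Sigma_0^{-1}$, $A_1=\Sigma_1^{-1}$, $C_0=A_0+r_0I$, $C_1=A_1+r_1I$, $\kappa=r_1-r_0$; $$S_*=\tfrac12\left[\kappa I+\left(\kappa^2I+4C_1^{1/2}C_0C_1^{1/2}\right)^{1/2}\right],\qquad L_*=C_1^{-1/2}S_*C_1^{-1/2};$$ $$P_*=[A_0+r_0(I-L_* )]^{-1},\qquad Q_*=L_*P_*L_*$$ (the matrices $P_*,Q_*$ are positive definite); $$h_*=(I+r_0\Sigma_0+r_1\Sigma_1)^{-1}(m_0-m_1),\qquad u_*=m_0-r_0\Sigma_0h_*,\qquad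 v_*=m_1+r_1\Sigma_1h_*;$$ $$p_*=\mathcal N(u_*,P_* ),\qquad q_*=\mathcal N(v_*,Q_* );$$ $$\mathcal A_*=W_2^2(p_*,q_* )+\tau_0\,\mathrm{KL}(p_*\mid\mu_0)+\tau_1\,\mathrm{KL}(q_*\mid\mu_1);$$ $$M_*=a^{\tau_0/(\tau_0+\tau_1)}\,b^{\tau_1/(\tau_0+\tau_1)}\exp\left(-\frac{\mathcal A_*}{\tau_0+\tau_1}\right).$$ $\pi_*$ is the Gaussian $W_2$-optimal coupling between $p_*$ and $q_*$, i.e. the law of $(X,\,v_*+L_*(X-u_* ))$ with $X\sim p_*$. *)

theory Defs
  imports "HOL-Probability.Probability"
begin

definition sym_posdef :: "real^'n^'n \<Rightarrow> bool" where
  "sym_posdef A \<longleftrightarrow> transpose A = A \<and> (\<forall>x. x \<noteq> 0 \<longrightarrow> x \<bullet> (A *v x) > 0)"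

definition sym_possemidef :: "real^'n^'n \<Rightarrow> bool" where
  "sym_possemidef A \<longleftrightarrow> transpose A = A \<and> (\<forall>x. x \<bullet> (A *v x) \<ge> 0)"

(* Principal square root of a symmetric positive semidefinite matrix
   (unspecified for other arguments). *)
definition mat_sqrt :: "real^'n^'n \<Rightarrow> real^'n^'n" where
  "mat_sqrt A = (THE B. sym_possemidef B \<and> B ** B = A)"

(* The nondegenerate Gaussian law N(m, \<Sigma>), given by its Lebesgue density;
   meaningful only for symmetric positive definite \<Sigma>. *)
definition gaussian :: "real^'n \<Rightarrow> real^'n^'n \<Rightarrow> (real^'n) measure" where
  "gaussian m \<Sigma> = density lborel
     (\<lambda>x. ennreal (exp (- ((x - m) \<bullet> (matrix_inv \<Sigma> *v (x - m))) / 2)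
                    / sqrt ((2 * pi) ^ CARD('n) * det \<Sigma>)))"

definition finite_borel_measures :: "'a::topological_space measure set" where
  "finite_borel_measures = {\<gamma>. sets \<gamma> = sets borel \<and> finite_measure \<gamma>}"

definition marginal0 :: "('a::topological_space \<times> 'a) measure \<Rightarrow> 'a measure" where
  "marginal0 \<gamma> = distr \<gamma> borel fst"

definition marginal1 :: "('a::topological_space \<times> 'a) measure \<Rightarrow> 'a measure" where
  "marginal1 \<gamma> = distr \<gamma> borel snd"

(* Generalized KL divergence between finite measures of possibly different mass.
   The integrand r log r - r + 1 is nonnegative (with 0 log 0 = 0, which holds for
   the total function ln), so the Lebesgue integral in [0,\<infinity>] always makes sense. *)
definition gen_KL :: "'a measure \<Rightarrow> 'a measure \<Rightarrow> ennreal" where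
  "gen_KL \<rho> \<eta> =
     (if absolutely_continuous \<eta> \<rho>
      then \<integral>\<^sup>+ x. (let r = enn2real (RN_deriv \<eta> \<rho> x) in ennreal (r * ln r - r + 1)) \<partial>\<eta>
      else \<infinity>)"

definition couplings :: "'a::euclidean_space measure \<Rightarrow> 'a measure \<Rightarrow> ('a \<times> 'a) measure set" where
  "couplings p q = {\<gamma> \<in> finite_borel_measures. marginal0 \<gamma> = p \<and> marginal1 \<gamma> = q}"

definition quad_cost :: "('a::euclidean_space \<times> 'a) measure \<Rightarrow> ennreal" where
  "quad_cost \<gamma> = (\<integral>\<^sup>+ (x, y). ennreal ((norm (x - y))\<^sup>2) \<partial>\<gamma>)"

(* For probability measures with finite second moments the infimum is finite,
   so that enn2real loses no information. *)
definition W2 :: "'a::euclidean_space measure \<Rightarrow> 'a measure \<Rightarrow> real" where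
  "W2 p q = sqrt (enn2real (INF \<gamma> \<in> couplings p q. quad_cost \<gamma>))"

definition unbalanced_objective ::
  "real \<Rightarrow> real \<Rightarrow> 'a::euclidean_space measure \<Rightarrow> 'a measure \<Rightarrow> ('a \<times> 'a) measure \<Rightarrow> ennreal" where
  "unbalanced_objective \<tau>0 \<tau>1 \<alpha> \<beta> \<gamma> =
     quad_cost \<gamma> + ennreal \<tau>0 * gen_KL (marginal0 \<gamma>) \<alpha>
                 + ennreal \<tau>1 * gen_KL (marginal1 \<gamma>) \<beta>"

definition KL_complementary_slackness ::
  "real \<Rightarrow> real \<Rightarrow> 'a::euclidean_space measure \<Rightarrow> 'a measure \<Rightarrow> ('a \<times> 'a) measure \<Rightarrow> bool" where
  "KL_complementary_slackness \<tau>0 \<tau>1 \<alpha> \<beta> \<gamma> \<longleftrightarrow>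
     (\<exists>\<phi> \<psi> :: 'a \<Rightarrow> real.
        \<phi> \<in> borel_measurable borel \<and> \<psi> \<in> borel_measurable borel \<and>
        (\<forall>x y. \<phi> x + \<psi> y \<le> (norm (x - y))\<^sup>2) \<and>
        marginal0 \<gamma> = density \<alpha> (\<lambda>x. ennreal (exp (- \<phi> x / \<tau>0))) \<and>
        marginal1 \<gamma> = density \<beta> (\<lambda>y. ennreal (exp (- \<psi> y / \<tau>1))) \<and>
        (AE (x, y) in \<gamma>. \<phi> x + \<psi> y = (norm (x - y))\<^sup>2))"

end

theory Submission
  imports Defs
begin

text \<open>
  Complementary slackness is sufficient for optimality: if \<open>\<phi> \<oplus> \<psi> \<le> c\<close>, then Young's inequality
  \<open>r ln r - r + s \<ge> r ln s\<close> with \<open>s = exp (- \<phi> / \<tau>)\<close> bounds the objective from below by a constant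
  depending on the potentials only.  Equality forces both densities to equal \<open>s\<close> and the plan to live
  on the contact set \<open>\<phi> \<oplus> \<psi> = c\<close>.  In the Gaussian case the log-densities of the candidate marginals
  are quadratic, and the matrix \<open>L\<close> solves a Riccati equation which makes \<open>c - \<phi> \<oplus> \<psi>\<close>, up to a
  constant, the square \<open>\<parallel>(y - v) - L (x - u)\<parallel>\<^sup>2\<close> in the metric \<open>L\<^sup>-\<^sup>1\<close>.  The total mass \<open>M\<close> is chosen so
  that the constant vanishes.  The contact set is then the graph of an affine map, so an optimal plan
  is determined by its first marginal.
\<close>

subsection \<open>Symmetric matrices and square roots\<close>

text \<open>The formula for \<open>L\<close> is a quadratic formula in disguise: conjugating the
  Riccati equation by the root of \<open>C1\<close> turns it into
  \<open>S ** S = \<kappa> *\<^sub>R S + K\<close>, and the principal square root selects the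
  positive definite solution. The constant \<open>A\<close> is defined through \<open>W2\<close> and
  two divergences, but it becomes explicit by duality: the same quadratic functions \<open>F\<close>
  and \<open>G\<close> are potentials for the balanced problem between \<open>p\<close> and
  \<open>q\<close> and appear in their log-densities. Their integrals cancel, leaving
  \<open>A = \<tau>0 * c0 + \<tau>1 * c1\<close>. The obstacle in the lower bound is integrability.
  A competitor of finite cost comes with no moments, so a quadratic potential must be shown
  integrable against its marginals from finiteness of the objective alone. Uniqueness tests one
  fixed pair of potentials against every minimizer; it therefore suffices to identify the first
  marginal.\<close>

lemma symmetric_inner: "transpose A = A \<Longrightarrow> x \<bullet> (A *v y) = (A *v x) \<bullet> y"
  for A :: "real^'n^'n"
  by (metis dot_lmul_matrix transpose_matrix_vector)

lemma symmetricI: "(\<And>x y. x \<bullet> (A *v y) = (A *v x) \<bullet> y) \<Longrightarrow> transpose A = A"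
  for A :: "real^'n^'n"
proof -
  assume "\<And>x y. x \<bullet> (A *v y) = (A *v x) \<bullet> y"
  then have "adjoint ((*v) A) = (*v) A" by (intro adjoint_unique) simp
  then have "(*v) (transpose A) = (*v) A" by (simp only: adjoint_matrix)
  then show ?thesis by (metis matrix_of_matrix_vector_mul)
qed

lemma matrix_mul_inv:
  fixes A :: "real^'n^'n"
  assumes "invertible A"
  shows "A ** matrix_inv A = mat 1" "matrix_inv A ** A = mat 1"
  using assms unfolding invertible_def matrix_inv_def by (metis (mono_tags, lifting) someI_ex)+

lemma matrix_inv_vector:
  fixes A :: "real^'n^'n"
  assumes "invertible A"
  shows "A *v (matrix_inv A *v x) = x" "matrix_inv A *v (A *v x) = x"
  by (simp_all add: matrix_vector_mul_assoc matrix_mul_inv[OF assms])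

lemma matrix_inv_eqI:
  fixes A B :: "real^'n^'n"
  assumes "A ** B = mat 1"
  shows "matrix_inv A = B"
proof -
  have "invertible A" using assms matrix_left_right_inverse unfolding invertible_def by blast
  then have "matrix_inv A ** (A ** B) = B" by (simp add: matrix_mul_assoc matrix_mul_inv)
  then show ?thesis by (simp add: assms)
qed

text \<open>Minimise the Rayleigh quotient on the compact unit sphere of \<open>V\<close>. Its first
  variation in the direction of the residual \<open>A *v v - c *\<^sub>R v\<close> must vanish, and
  invariance of \<open>V\<close> keeps that direction inside \<open>V\<close>. Proper subspaces
  serve the induction on dimension; minimality of \<open>c\<close> serves the positivity
  arguments.\<close>

lemma symmetric_eigenvector_minimizing:
  fixes A :: "real^'n^'n"
  assumes sym: "transpose A = A" and V: "subspace V" "w \<in> V" "w \<noteq> 0"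
    and inv: "\<And>x. x \<in> V \<Longrightarrow> A *v x \<in> V"
  obtains v c where "v \<in> V" "norm v = 1" "A *v v = c *\<^sub>R v"
    "\<And>x. x \<in> V \<Longrightarrow> c * (x \<bullet> x) \<le> x \<bullet> (A *v x)"
proof -
  have "compact (sphere 0 1 \<inter> V)"
    using V(1) closed_subspace compact_Int_closed compact_sphere by blast
  moreover have "(1 / norm w) *\<^sub>R w \<in> sphere 0 1 \<inter> V"
    using V by (simp add: subspace_scale)
  moreover have "continuous_on (sphere 0 1 \<inter> V) (\<lambda>x. x \<bullet> (A *v x))"
    by (intro continuous_intros linear_continuous_on matrix_vector_mul_bounded_linear)
  ultimately obtain v where v: "v \<in> sphere 0 1 \<inter> V"
    and min: "\<And>x. x \<in> sphere 0 1 \<inter> V \<Longrightarrow> v \<bullet> (A *v v) \<le> x \<bullet> (A *v x)"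
    using continuous_attains_inf[of "sphere 0 1 \<inter> V" "\<lambda>x. x \<bullet> (A *v x)"] by blast
  define c where "c = v \<bullet> (A *v v)"
  have v1: "v \<bullet> v = 1" "v \<in> V" using v by (auto simp: norm_eq_1)
  have le: "c * (x \<bullet> x) \<le> x \<bullet> (A *v x)" if "x \<in> V" for x
  proof (cases "x = 0")
    case False
    have "(1 / norm x) *\<^sub>R x \<in> sphere 0 1 \<inter> V"
      using that False V(1) by (simp add: subspace_scale)
    from min[OF this] have "c \<le> (x \<bullet> (A *v x)) / (x \<bullet> x)"
      by (simp add: c_def matrix_vector_mult_scaleR power2_norm_eq_inner[symmetric] power2_eq_square)
    then show ?thesis using False by (simp add: field_simps)
  qed simp
  \<comment> \<open>\<open>g\<close> is half the gradient of the Rayleigh quotient at the unit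
    vector \<open>v\<close>; the aim is \<open>g = 0\<close>.\<close>
  define g where "g = A *v v - c *\<^sub>R v"
  have g: "g \<in> V" using v1 inv V(1) by (simp add: g_def subspace_diff subspace_scale)
  define b where "b = g \<bullet> (A *v g) - c * (g \<bullet> g)"
  have quad: "0 \<le> 2 * t * (g \<bullet> g) + t\<^sup>2 * b" for t
  proof -
    have "v + t *\<^sub>R g \<in> V" using V(1) v1(2) g by (simp add: subspace_add subspace_scale)
    from le[OF this] have "0 \<le> (v + t *\<^sub>R g) \<bullet> (A *v (v + t *\<^sub>R g)) - c * ((v + t *\<^sub>R g) \<bullet> (v + t *\<^sub>R g))"
      by simp
    also have "\<dots> = 2 * t * (g \<bullet> (A *v v) - c * (g \<bullet> v)) + t\<^sup>2 * b"
    proof -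
      have "v \<bullet> (A *v g) = g \<bullet> (A *v v)" "v \<bullet> g = g \<bullet> v"
        using symmetric_inner[OF sym, of v g] by (simp_all add: inner_commute)
      then show ?thesis
        unfolding b_def
        by (simp add: matrix_vector_right_distrib matrix_vector_mult_scaleR inner_add_left
            inner_add_right v1 c_def[symmetric] power2_eq_square) (simp add: algebra_simps)
    qed
    also have "g \<bullet> (A *v v) - c * (g \<bullet> v) = g \<bullet> g"
      by (simp add: g_def inner_diff inner_scaleR_right)
    finally show ?thesis .
  qed
  \<comment> \<open>The coefficient \<open>b\<close> may have either sign. With the positive bound
    \<open>k\<close> in its place, \<open>t = - (g \<bullet> g) / k\<close> makes the right-hand
    side of \<open>quad\<close> strictly negative unless \<open>g\<close> vanishes.\<close>
  define k where "k = \<bar>b\<bar> + 1"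
  have k: "k > 0" "b \<le> k" by (auto simp: k_def)
  have "g \<bullet> g = 0"
  proof (rule ccontr)
    let ?a = "g \<bullet> g"
    assume "?a \<noteq> 0"
    then have a: "?a > 0" by (metis inner_ge_zero less_eq_real_def)
    have "0 \<le> 2 * (- ?a / k) * ?a + (- ?a / k)\<^sup>2 * b" by (rule quad)
    also have "\<dots> \<le> 2 * (- ?a / k) * ?a + (- ?a / k)\<^sup>2 * k"
      using k by (intro add_left_mono mult_left_mono) auto
    also have "\<dots> = - (?a\<^sup>2 / k)"
      using k by (simp add: power2_eq_square field_simps)
    finally show False using a k by (simp add: divide_le_0_iff not_le zero_less_power)
  qed
  then have "A *v v = c *\<^sub>R v" by (simp add: g_def)
  then show thesis using that[of v c] le v1 by (simp add: norm_eq_1)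
qed

text \<open>The minimising eigenvalue bounds the quadratic form from below. The test suits matrices
  built from square roots, whose eigenvectors are easier to control than their quadratic
  forms.\<close>

lemma sym_posdefI_eigen:
  fixes A :: "real^'n^'n"
  assumes sym: "transpose A = A"
    and pos: "\<And>e c. norm e = 1 \<Longrightarrow> A *v e = c *\<^sub>R e \<Longrightarrow> c > 0"
  shows "sym_posdef A"
  unfolding sym_posdef_def
proof (intro conjI allI impI sym)
  fix x :: "real^'n" assume "x \<noteq> 0"
  then obtain v c where "norm v = 1" "A *v v = c *\<^sub>R v" "c * (x \<bullet> x) \<le> x \<bullet> (A *v x)"
    using symmetric_eigenvector_minimizing[OF sym subspace_UNIV, of x] by (metis UNIV_I)
  with pos[of v c] \<open>x \<noteq> 0\<close> show "0 < x \<bullet> (A *v x)"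
    by (meson inner_gt_zero_iff mult_pos_pos order_less_le_trans)
qed

text \<open>Kept as a set of vectors with an eigenvalue function and an expansion formula, since
  later uses evaluate linear maps on the expansion. The clause with the sum expresses completeness
  in \<open>V\<close>.\<close>

definition orthonormal_eigenbasis ::
    "real^'n^'n \<Rightarrow> (real^'n) set \<Rightarrow> (real^'n) set \<Rightarrow> (real^'n \<Rightarrow> real) \<Rightarrow> bool" where
  "orthonormal_eigenbasis A V B c \<longleftrightarrow> finite B \<and> B \<subseteq> V \<and> (\<forall>b\<in>B. norm b = 1 \<and> A *v b = c b *\<^sub>R b)
    \<and> (\<forall>x\<in>V. (\<Sum>b\<in>B. (x \<bullet> b) *\<^sub>R b) = x) \<and> (\<forall>b\<in>B. \<forall>b'\<in>B. b \<noteq> b' \<longrightarrow> b \<bullet> b' = 0)"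

lemma orthonormal_eigenbasis_UNIV:
  assumes "orthonormal_eigenbasis A UNIV B c"
  shows "finite B" "b \<in> B \<Longrightarrow> norm b = 1" "b \<in> B \<Longrightarrow> A *v b = c b *\<^sub>R b"
    "(\<Sum>b\<in>B. (x \<bullet> b) *\<^sub>R b) = x" "b \<in> B \<Longrightarrow> b' \<in> B \<Longrightarrow> b \<noteq> b' \<Longrightarrow> b \<bullet> b' = 0"
  using assms by (auto simp: orthonormal_eigenbasis_def)

text \<open>Induction on the dimension of \<open>V\<close>: by symmetry the orthogonal complement of
  an eigenvector is again invariant, and it is strictly smaller.\<close>

lemma symmetric_orthonormal_eigenbasis:
  fixes A :: "real^'n^'n"
  assumes sym: "transpose A = A" and "subspace V" "\<And>x. x \<in> V \<Longrightarrow> A *v x \<in> V"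
  shows "\<exists>B c. orthonormal_eigenbasis A V B c"
  using assms(2,3)
proof (induction "dim V" arbitrary: V rule: less_induct)
  case less
  show ?case
  proof (cases "\<exists>w\<in>V. w \<noteq> 0")
    case False
    then show ?thesis by (intro exI[of _ "{}"]) (auto simp: orthonormal_eigenbasis_def)
  next
    case True
    then obtain v c where v: "v \<in> V" "norm v = 1" "A *v v = c *\<^sub>R v"
      using symmetric_eigenvector_minimizing[OF sym less.prems(1) _ _ less.prems(2)] by metis
    define V' where "V' = V \<inter> {y. v \<bullet> y = 0}"
    have sub: "subspace V'"
      unfolding V'_def using less.prems(1) by (simp add: subspace_inter subspace_hyperplane)
    have "v \<notin> V'" using v by (auto simp: V'_def)
    then have "V' \<subset> V" using v(1) unfolding V'_def by blast
    then have dim: "dim V' < dim V"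
      using sub less.prems(1) by (intro dim_psubset) (metis span_eq_iff)
    have inv: "A *v x \<in> V'" if "x \<in> V'" for x
      using that less.prems(2) symmetric_inner[OF sym, of v x] v(3) by (auto simp: V'_def)
    from less.hyps[OF dim sub inv] obtain B c' where
      B: "finite B" "B \<subseteq> V'" "\<forall>b\<in>B. norm b = 1 \<and> A *v b = c' b *\<^sub>R b"
      "\<forall>x\<in>V'. (\<Sum>b\<in>B. (x \<bullet> b) *\<^sub>R b) = x" "\<forall>b\<in>B. \<forall>b'\<in>B. b \<noteq> b' \<longrightarrow> b \<bullet> b' = 0"
      unfolding orthonormal_eigenbasis_def by blast
    have vB: "v \<notin> B" using B(2) v by (auto simp: V'_def norm_eq_1)
    have vb: "v \<bullet> b = 0" "b \<bullet> v = 0" if "b \<in> B" for b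
      using that B(2) by (auto simp: V'_def inner_commute)
    have exp: "(\<Sum>b\<in>insert v B. (x \<bullet> b) *\<^sub>R b) = x" if "x \<in> V" for x
    proof -
      have "x - (x \<bullet> v) *\<^sub>R v \<in> V'"
        using that v less.prems(1)
        by (auto simp: V'_def subspace_diff subspace_scale inner_diff_right norm_eq_1 inner_commute)
      with B(4) have "(\<Sum>b\<in>B. ((x - (x \<bullet> v) *\<^sub>R v) \<bullet> b) *\<^sub>R b) = x - (x \<bullet> v) *\<^sub>R v" by blast
      moreover have "(\<Sum>b\<in>B. ((x - (x \<bullet> v) *\<^sub>R v) \<bullet> b) *\<^sub>R b) = (\<Sum>b\<in>B. (x \<bullet> b) *\<^sub>R b)"
        using vb by (intro sum.cong) (auto simp: inner_diff_left)
      ultimately show ?thesis using B(1) vB by simp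
    qed
    show ?thesis
      by (rule exI[of _ "insert v B"], rule exI[of _ "c'(v := c)"])
        (use B v vB vb exp in \<open>auto simp: V'_def orthonormal_eigenbasis_def\<close>)
  qed
qed

text \<open>Take square roots of the eigenvalues in an eigenbasis; semidefiniteness makes them
  nonnegative, so squaring restores them.\<close>

lemma possemidef_sqrt_exists:
  fixes A :: "real^'n^'n"
  assumes "sym_possemidef A"
  shows "\<exists>R. sym_possemidef R \<and> R ** R = A"
proof -
  obtain B c where "orthonormal_eigenbasis A UNIV B c"
    using symmetric_orthonormal_eigenbasis[of A UNIV] assms unfolding sym_possemidef_def by auto
  note B = orthonormal_eigenbasis_UNIV[OF this]
  have c: "c b \<ge> 0" if "b \<in> B" for b
    using assms B(2)[OF that] B(3)[OF that] unfolding sym_possemidef_def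
    by (metis inner_scaleR_right mult.right_neutral norm_eq_1)
  define f where "f x = (\<Sum>b\<in>B. (sqrt (c b) * (x \<bullet> b)) *\<^sub>R b)" for x
  have lin: "linear f"
    unfolding f_def
    by (rule linearI) (simp_all add: inner_add_left algebra_simps sum.distrib scaleR_sum_right)
  define R where "R = matrix f"
  have R: "R *v x = f x" for x using lin by (simp add: R_def matrix_works)
  have fb: "f b = sqrt (c b) *\<^sub>R b" if "b \<in> B" for b
  proof -
    have "f b = (\<Sum>b'\<in>B. if b' = b then sqrt (c b) *\<^sub>R b else 0)"
      unfolding f_def using that B(2,5) by (intro sum.cong) (auto simp: norm_eq_1)
    then show ?thesis using that B(1) by simp
  qed
  have "R ** R = A"
  proof (subst matrix_eq, rule allI)
    fix x
    have "(R ** R) *v x = f (f x)" by (simp add: R flip: matrix_vector_mul_assoc)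
    also have "\<dots> = (\<Sum>b\<in>B. (sqrt (c b) * (x \<bullet> b)) *\<^sub>R f b)"
      by (subst (2) f_def) (simp add: linear_sum[OF lin] linear_cmul[OF lin])
    also have "\<dots> = (\<Sum>b\<in>B. (x \<bullet> b) *\<^sub>R (A *v b))"
      using c by (intro sum.cong) (auto simp: fb B(3))
    also have "\<dots> = A *v (\<Sum>b\<in>B. (x \<bullet> b) *\<^sub>R b)"
      by (simp add: linear_sum[OF matrix_vector_mul_linear] matrix_vector_mult_scaleR)
    finally show "(R ** R) *v x = A *v x" using B(4)[of x] by simp
  qed
  moreover have "sym_possemidef R"
    unfolding sym_possemidef_def
  proof
    show "transpose R = R"
      by (rule symmetricI)
        (simp add: R f_def inner_sum_left inner_sum_right inner_commute algebra_simps)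
    show "\<forall>x. 0 \<le> x \<bullet> (R *v x)"
      using c by (auto simp: R f_def inner_sum_right mult.assoc intro!: sum_nonneg)
  qed
  ultimately show ?thesis by blast
qed

text \<open>By symmetry the squared norm of \<open>A *v x\<close> is
  \<open>x \<bullet> (A *v (A *v x))\<close>. This settles the zero eigenvalue in the uniqueness of
  square roots.\<close>

lemma symmetric_square_kernel:
  fixes A :: "real^'n^'n"
  assumes "transpose A = A" "A *v (A *v x) = 0"
  shows "A *v x = 0"
  using assms symmetric_inner[of A x "A *v x"] by simp

text \<open>It is enough to compare \<open>T\<close> with \<open>R\<close> on an eigenvector
  \<open>b\<close> of \<open>R\<close>. There \<open>(T + c b) (T - c b) b = 0\<close>, and a
  semidefinite \<open>T\<close> cannot have the eigenvalue \<open>- c b\<close> when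
  \<open>c b > 0\<close>.\<close>

lemma possemidef_sqrt_unique:
  fixes R T :: "real^'n^'n"
  assumes R: "sym_possemidef R" and T: "sym_possemidef T" and eq: "R ** R = T ** T"
  shows "R = T"
proof -
  have symR: "transpose R = R" and symT: "transpose T = T"
    using R T by (auto simp: sym_possemidef_def)
  obtain B c where "orthonormal_eigenbasis R UNIV B c"
    using symmetric_orthonormal_eigenbasis[OF symR subspace_UNIV] by auto
  note B = orthonormal_eigenbasis_UNIV[OF this]
  have Tb: "T *v b = c b *\<^sub>R b" if "b \<in> B" for b
  proof -
    have c: "c b \<ge> 0"
      using R B(2,3)[OF that] unfolding sym_possemidef_def
      by (metis inner_scaleR_right mult.right_neutral norm_eq_1)
    have TT: "T *v (T *v b) = (c b * c b) *\<^sub>R b"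
      using B(3)[OF that] eq by (metis matrix_vector_mul_assoc matrix_vector_mult_scaleR scaleR_scaleR)
    show ?thesis
    proof (cases "c b = 0")
      case True
      with TT symmetric_square_kernel[OF symT, of b] show ?thesis by simp
    next
      case False
      \<comment> \<open>If it were nonzero, \<open>d\<close> would be an eigenvector of
        \<open>T\<close> for the negative eigenvalue \<open>- c b\<close>.\<close>
      define d where "d = T *v b - c b *\<^sub>R b"
      have "T *v d = - c b *\<^sub>R d"
        by (simp add: d_def TT matrix_vector_mult_diff_distrib matrix_vector_mult_scaleR scaleR_diff_right)
      then have "0 \<le> - (c b * (d \<bullet> d))" using T unfolding sym_possemidef_def
        by (metis inner_scaleR_right mult_minus_left)
      then have "d \<bullet> d \<le> 0" using c False by (simp add: mult_le_0_iff)
      then have "d = 0" by (metis inner_gt_zero_iff not_le)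
      then show ?thesis by (simp add: d_def)
    qed
  qed
  show ?thesis
  proof (subst matrix_eq, rule allI)
    fix x
    have "R *v (\<Sum>b\<in>B. (x \<bullet> b) *\<^sub>R b) = T *v (\<Sum>b\<in>B. (x \<bullet> b) *\<^sub>R b)"
      by (simp add: linear_sum[OF matrix_vector_mul_linear] matrix_vector_mult_scaleR B(3) Tb)
    then show "R *v x = T *v x" using B(4)[of x] by simp
  qed
qed

text \<open>Existence and uniqueness together discharge the definite description in
  \<open>mat_sqrt\<close>.\<close>

lemma mat_sqrt_possemidef:
  fixes A :: "real^'n^'n"
  assumes "sym_possemidef A"
  shows "sym_possemidef (mat_sqrt A)" "mat_sqrt A ** mat_sqrt A = A"
proof -
  have "\<exists>!R. sym_possemidef R \<and> R ** R = A"
    using possemidef_sqrt_exists[OF assms] possemidef_sqrt_unique by metis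
  from theI'[OF this] show "sym_possemidef (mat_sqrt A)" "mat_sqrt A ** mat_sqrt A = A"
    unfolding mat_sqrt_def by auto
qed

lemma sym_posdef_imp_possemidef: "sym_posdef A \<Longrightarrow> sym_possemidef A"
  unfolding sym_posdef_def sym_possemidef_def
  by (metis inner_zero_left order_le_less)

lemma sym_posdef_invertible:
  fixes A :: "real^'n^'n"
  assumes "sym_posdef A"
  shows "invertible A"
proof -
  have "\<forall>x. A *v x = 0 \<longrightarrow> x = 0"
    using assms unfolding sym_posdef_def by (metis inner_zero_right less_irrefl)
  then show ?thesis using invertible_left_inverse matrix_left_invertible_ker by blast
qed

lemma mat_sqrt_posdef:
  fixes A :: "real^'n^'n"
  assumes "sym_posdef A"
  shows "sym_posdef (mat_sqrt A)" "mat_sqrt A ** mat_sqrt A = A"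
proof -
  note psd = sym_posdef_imp_possemidef[OF assms]
  show sq: "mat_sqrt A ** mat_sqrt A = A" by (rule mat_sqrt_possemidef[OF psd])
  show "sym_posdef (mat_sqrt A)"
  proof (rule sym_posdefI_eigen)
    show "transpose (mat_sqrt A) = mat_sqrt A"
      using mat_sqrt_possemidef(1)[OF psd] by (simp add: sym_possemidef_def)
    fix e c assume e: "norm e = 1" "mat_sqrt A *v e = c *\<^sub>R e"
    have "0 \<le> e \<bullet> (mat_sqrt A *v e)"
      using mat_sqrt_possemidef(1)[OF psd] by (simp add: sym_possemidef_def)
    then have "c \<ge> 0" using e by (simp add: norm_eq_1)
    moreover have "c \<noteq> 0"
    proof
      assume "c = 0"
      then have "A *v e = 0" using e sq by (metis matrix_vector_mul_assoc matrix_vector_mult_0_right scaleR_zero_left)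
      then show False using assms e unfolding sym_posdef_def
        by (metis inner_zero_right less_irrefl norm_zero zero_neq_one)
    qed
    ultimately show "c > 0" by simp
  qed
qed

lemma symmetric_matrix_inv:
  fixes A :: "real^'n^'n"
  assumes "invertible A" "transpose A = A"
  shows "transpose (matrix_inv A) = matrix_inv A"
proof -
  have "transpose (matrix_inv A ** A) = mat 1" by (simp add: matrix_mul_inv[OF assms(1)])
  then have "A ** transpose (matrix_inv A) = mat 1" by (simp add: matrix_transpose_mul assms(2))
  from matrix_inv_eqI[OF this] show ?thesis by simp
qed

lemma sym_posdef_inv:
  fixes A :: "real^'n^'n"
  assumes "sym_posdef A"
  shows "sym_posdef (matrix_inv A)"
  unfolding sym_posdef_def
proof (intro conjI allI impI)
  note inv = sym_posdef_invertible[OF assms]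
  show "transpose (matrix_inv A) = matrix_inv A"
    using assms inv symmetric_matrix_inv by (auto simp: sym_posdef_def)
  fix x :: "real^'n" assume "x \<noteq> 0"
  then have "matrix_inv A *v x \<noteq> 0" by (metis inv matrix_inv_vector(1) matrix_vector_mult_0_right)
  then have "0 < (matrix_inv A *v x) \<bullet> (A *v (matrix_inv A *v x))"
    using assms by (auto simp: sym_posdef_def)
  then show "0 < x \<bullet> (matrix_inv A *v x)"
    by (simp add: matrix_inv_vector[OF inv] inner_commute)
qed

lemma sym_posdef_congruence:
  fixes A B :: "real^'n^'n"
  assumes "sym_posdef A" "invertible B"
  shows "sym_posdef (transpose B ** A ** B)"
  unfolding sym_posdef_def
proof (intro conjI allI impI)
  show "transpose (transpose B ** A ** B) = transpose B ** A ** B"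
    using assms by (simp add: matrix_transpose_mul matrix_mul_assoc sym_posdef_def)
  fix x :: "real^'n" assume "x \<noteq> 0"
  then have "B *v x \<noteq> 0" by (metis assms(2) matrix_inv_vector(2) matrix_vector_mult_0_right)
  then have "0 < (B *v x) \<bullet> (A *v (B *v x))" using assms by (auto simp: sym_posdef_def)
  then show "0 < x \<bullet> ((transpose B ** A ** B) *v x)"
    using dot_lmul_matrix[of "A *v (B *v x)" B x]
    by (simp add: matrix_vector_mul_assoc[symmetric] inner_commute)
qed

lemma sym_posdef_sandwich:
  fixes A B :: "real^'n^'n"
  assumes "sym_posdef A" "sym_posdef B"
  shows "sym_posdef (B ** A ** B)"
  using sym_posdef_congruence[OF assms(1) sym_posdef_invertible[OF assms(2)]] assms(2)
  by (simp add: sym_posdef_def)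

lemma transpose_add: "transpose (A + B) = transpose A + transpose B"
  by (simp add: transpose_def vec_eq_iff)

lemma transpose_diff: "transpose (A - B) = transpose A - transpose B"
  for A :: "'a::ab_group_add^'n^'m"
  by (simp add: transpose_def vec_eq_iff)

lemma sym_posdef_add: "sym_posdef A \<Longrightarrow> sym_posdef B \<Longrightarrow> sym_posdef (A + B)"
  by (simp add: sym_posdef_def transpose_add matrix_vector_mult_add_rdistrib inner_add_right add_pos_pos)

lemma sym_posdef_scaleR: "sym_posdef A \<Longrightarrow> c > 0 \<Longrightarrow> sym_posdef (c *\<^sub>R A)"
  by (simp add: sym_posdef_def transpose_scalar flip: scaleR_matrix_vector_assoc)

lemma sym_posdef_mat_1: "sym_posdef (mat 1)"
  by (simp add: sym_posdef_def)

text \<open>The square root exhibits the determinant as a square, and invertibility excludes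
  zero.\<close>

lemma det_posdef_pos:
  fixes A :: "real^'n^'n"
  assumes "sym_posdef A"
  shows "det A > 0"
proof -
  have "det A = (det (mat_sqrt A))\<^sup>2"
    using det_mul[of "mat_sqrt A" "mat_sqrt A"]
    by (simp add: mat_sqrt_posdef(2)[OF assms] power2_eq_square)
  moreover have "det A \<noteq> 0" using sym_posdef_invertible[OF assms] invertible_det_nz by blast
  ultimately show ?thesis by simp
qed

subsection \<open>Gaussian measures\<close>

lemma matrix_vector_measurable [measurable]:
  fixes A :: "real^'n^'m"
  assumes "f \<in> borel_measurable M"
  shows "(\<lambda>x. A *v f x) \<in> borel_measurable M"
proof -
  have "(*v) A \<in> borel \<rightarrow>\<^sub>M borel"
    by (intro borel_measurable_continuous_onI linear_continuous_on matrix_vector_mul_bounded_linear)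
  from measurable_compose[OF assms this] show ?thesis .
qed

text \<open>Uniqueness of Haar measure for Lebesgue measure, by evaluating
  \<open>\<integral>\<integral> F (x + y) G y d\<nu> dy\<close> in both orders.\<close>

lemma translation_invariant_lborel:
  fixes \<nu> :: "'a::euclidean_space measure"
  assumes sets [measurable_cong]: "sets \<nu> = sets borel" and "sigma_finite_measure \<nu>"
    and inv: "\<And>c. distr \<nu> borel (\<lambda>x. x + c) = \<nu>"
    and F [measurable]: "F \<in> sets borel" and G [measurable]: "G \<in> sets borel"
  shows "emeasure \<nu> F * emeasure lborel G = emeasure lborel F * emeasure \<nu> (uminus -` G)"
proof -
  interpret \<nu>: sigma_finite_measure \<nu> by fact
  interpret pair_sigma_finite \<nu> lborel ..
  have G' [measurable]: "uminus -` G \<in> sets borel"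
    using measurable_sets[of uminus borel borel G] by simp
  have shift: "(\<integral>\<^sup>+x. indicator H (x + c) \<partial>\<nu>) = emeasure \<nu> H" if [measurable]: "H \<in> sets borel" for H c
  proof -
    have "(\<integral>\<^sup>+x. indicator H (x + c) \<partial>\<nu>) = (\<integral>\<^sup>+x. indicator H x \<partial>distr \<nu> borel (\<lambda>x. x + c))"
      by (subst nn_integral_distr) auto
    then show ?thesis by (simp add: inv sets)
  qed
  have "emeasure \<nu> F * emeasure lborel G = (\<integral>\<^sup>+y. (\<integral>\<^sup>+x. indicator F (x + y) \<partial>\<nu>) * indicator G y \<partial>lborel)"
    by (simp add: shift nn_integral_cmult)
  also have "\<dots> = (\<integral>\<^sup>+y. \<integral>\<^sup>+x. indicator F (x + y) * indicator G y \<partial>\<nu> \<partial>lborel)"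
    by (simp add: nn_integral_multc)
  also have "\<dots> = (\<integral>\<^sup>+x. \<integral>\<^sup>+y. indicator F (x + y) * indicator G y \<partial>lborel \<partial>\<nu>)"
    by (rule Fubini') measurable
  \<comment> \<open>Translating Lebesgue measure in the inner integral moves \<open>x\<close> from
    \<open>F\<close> to \<open>G\<close>. After exchanging back, invariance of \<open>\<nu>\<close>
    removes \<open>y\<close> and leaves the reflected set.\<close>
  also have "\<dots> = (\<integral>\<^sup>+x. \<integral>\<^sup>+y. indicator F y * indicator G (y - x) \<partial>lborel \<partial>\<nu>)"
  proof (rule nn_integral_cong)
    fix x :: 'a
    have "(\<integral>\<^sup>+y. indicator F y * indicator G (y - x) \<partial>distr lborel borel ((+) x))
      = (\<integral>\<^sup>+y. indicator F (x + y) * indicator G y \<partial>lborel)"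
      by (subst nn_integral_distr) auto
    then show "(\<integral>\<^sup>+y. indicator F (x + y) * indicator G y \<partial>lborel)
      = (\<integral>\<^sup>+y. indicator F y * indicator G (y - x) \<partial>lborel)"
      by (simp add: lborel_distr_plus)
  qed
  also have "\<dots> = (\<integral>\<^sup>+y. \<integral>\<^sup>+x. indicator F y * indicator G (y - x) \<partial>\<nu> \<partial>lborel)"
    by (rule Fubini'[symmetric]) measurable
  also have "\<dots> = (\<integral>\<^sup>+y. indicator F y * emeasure \<nu> (uminus -` G) \<partial>lborel)"
  proof (rule nn_integral_cong)
    fix y :: 'a
    have "indicator G (y - x) = (indicator (uminus -` G) (x + - y) :: ennreal)" for x
      by (simp add: indicator_def)
    then show "(\<integral>\<^sup>+x. indicator F y * indicator G (y - x) \<partial>\<nu>) = indicator F y * emeasure \<nu> (uminus -` G)"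
      by (simp add: nn_integral_cmult shift del: add_uminus_conv_diff)
  qed
  also have "\<dots> = emeasure lborel F * emeasure \<nu> (uminus -` G)"
    by (simp add: nn_integral_multc)
  finally show ?thesis .
qed

text \<open>The change of variables formula of the library is restricted to well-ordered index types.
  Here the scaling factor of Lebesgue measure is shown to exist by translation
  invariance; it is multiplicative in the matrix, so it suffices to know it for elementary matrices.\<close>

definition lborel_scaling :: "real^'n^'n \<Rightarrow> real \<Rightarrow> bool" where
  "lborel_scaling A k \<longleftrightarrow> k > 0 \<and>
     (\<forall>F\<in>sets borel. emeasure lborel ((*v) A -` F) = ennreal k * emeasure lborel F)"

lemma vimage_matrix_borel [measurable]: "F \<in> sets borel \<Longrightarrow> (*v) A -` F \<in> sets borel"
  for A :: "real^'n^'m"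
  using measurable_sets[of "(*v) A" borel borel F] by simp

text \<open>The image of Lebesgue measure under \<open>A\<close> is again translation invariant,
  hence a multiple of Lebesgue measure. The unit ball is the reference set: it equals its own
  reflection, has positive finite volume, and has a bounded preimage.\<close>

lemma lborel_scaling_exists:
  fixes A :: "real^'n^'n"
  assumes inv: "invertible A"
  shows "\<exists>k. lborel_scaling A k"
proof -
  let ?\<nu> = "distr lborel borel ((*v) A)"
  let ?B = "ball (0 :: real^'n) 1"
  have [measurable]: "(*v) A \<in> borel \<rightarrow>\<^sub>M borel" "(*v) (matrix_inv A) \<in> borel \<rightarrow>\<^sub>M borel" by auto
  have "distr ?\<nu> borel ((*v) (matrix_inv A)) = distr lborel borel (\<lambda>x. x)"
    by (simp add: distr_distr comp_def matrix_inv_vector[OF inv])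
  also have "\<dots> = lborel" by (simp add: distr_id2)
  finally have "sigma_finite_measure (distr ?\<nu> borel ((*v) (matrix_inv A)))"
    by (simp add: lborel.sigma_finite_measure_axioms)
  then have sf: "sigma_finite_measure ?\<nu>"
    by (rule sigma_finite_measure_distr) simp
  have ti: "distr ?\<nu> borel (\<lambda>x. x + c) = ?\<nu>" for c
  proof -
    have "distr ?\<nu> borel (\<lambda>x. x + c) = distr (distr lborel borel ((+) (matrix_inv A *v c))) borel ((*v) A)"
      by (simp add: distr_distr comp_def matrix_vector_right_distrib matrix_inv_vector[OF inv] add.commute)
    then show ?thesis by (simp add: lborel_distr_plus)
  qed
  have sym: "uminus -` ?B = ?B" by auto
  have B0: "emeasure lborel ?B \<noteq> 0" "emeasure lborel ?B < \<infinity>"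
    using emeasure_bounded_finite[of ?B] open_not_negligible[of ?B]
    by (auto simp: negligible_iff_emeasure0)
  have "bounded ((*v) (matrix_inv A) ` ?B)"
    by (intro bounded_linear_image matrix_vector_mul_bounded_linear bounded_ball)
  moreover have AB: "(*v) A -` ?B = (*v) (matrix_inv A) ` ?B"
    by (force simp: image_iff matrix_inv_vector[OF inv])
  ultimately have \<nu>B: "emeasure ?\<nu> ?B < \<infinity>"
    using emeasure_bounded_finite by (simp add: emeasure_distr)
  define c where "c = emeasure ?\<nu> ?B / emeasure lborel ?B"
  have c: "emeasure ?\<nu> F = c * emeasure lborel F" if "F \<in> sets borel" for F
  proof -
    have "emeasure ?\<nu> F * emeasure lborel ?B = emeasure lborel F * emeasure ?\<nu> ?B"
      using translation_invariant_lborel[OF _ sf ti that, of ?B] by (simp add: sym)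
    then have "emeasure ?\<nu> F * emeasure lborel ?B / emeasure lborel ?B = c * emeasure lborel F"
      by (simp add: c_def ennreal_divide_times ennreal_times_divide mult.commute)
    then show ?thesis using B0 by (simp add: ennreal_times_divide[symmetric] ennreal_divide_self)
  qed
  have "c < \<infinity>" using \<nu>B B0 by (simp add: c_def ennreal_divide_eq_top_iff less_top[symmetric])
  moreover have "c \<noteq> 0"
  proof
    assume "c = 0"
    then have "emeasure ?\<nu> UNIV = 0" using c[of UNIV] by simp
    then show False by (simp add: emeasure_distr)
  qed
  ultimately have "lborel_scaling A (enn2real c)"
    using c by (auto simp: lborel_scaling_def emeasure_distr enn2real_positive_iff zero_less_iff_neq_zero)
  then show ?thesis ..
qed

lemma lborel_scaling_mult:
  assumes "lborel_scaling A k" "lborel_scaling B l"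
  shows "lborel_scaling (A ** B) (k * l)"
proof -
  have "(*v) (A ** B) -` F = (*v) B -` ((*v) A -` F)" for F
    by (auto simp: matrix_vector_mul_assoc)
  then show ?thesis
    using assms by (auto simp: lborel_scaling_def ennreal_mult mult_ac)
qed

lemma lborel_scaling_unique:
  fixes A :: "real^'n^'n"
  assumes "lborel_scaling A k" "lborel_scaling A l"
  shows "k = l"
proof -
  let ?I = "cbox 0 (\<Sum>Basis) :: (real^'n) set"
  have "ennreal k * emeasure lborel ?I = ennreal l * emeasure lborel ?I"
    using assms[unfolded lborel_scaling_def] borel_closed[OF closed_cbox, of 0 "\<Sum>Basis"]
    by (metis (no_types))
  moreover have "emeasure lborel ?I = 1"
    by (simp add: emeasure_lborel_cbox_eq)
  ultimately show ?thesis using assms by (simp add: lborel_scaling_def)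
qed

text \<open>Both the scaling factor and the determinant are multiplicative, so elementary factors
  suffice. A zero row contradicts invertibility; for a diagonal matrix a suitable box has a cube as
  preimage; a transposition squares to the identity; a shear is treated by conjugation. The
  reciprocal appears because \<open>lborel_scaling\<close> measures preimages.\<close>

lemma lborel_scaling_det:
  fixes A :: "real^'n^'n"
  shows "invertible A \<Longrightarrow> lborel_scaling A (1 / \<bar>det A\<bar>)"
proof (induction A rule: induct_matrix_elementary_alt)
  fix A B :: "real^'n^'n"
  assume IH: "invertible A \<Longrightarrow> lborel_scaling A (1 / \<bar>det A\<bar>)"
    "invertible B \<Longrightarrow> lborel_scaling B (1 / \<bar>det B\<bar>)" and "invertible (A ** B)"
  then have "invertible A" "invertible B" by (simp_all add: invertible_det_nz det_mul)
  from lborel_scaling_mult[OF IH(1)[OF this(1)] IH(2)[OF this(2)]]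
  show "lborel_scaling (A ** B) (1 / \<bar>det (A ** B)\<bar>)" by (simp add: det_mul abs_mult)
next
  fix A :: "real^'n^'n" and i assume "row i A = 0" "invertible A"
  then show "lborel_scaling A (1 / \<bar>det A\<bar>)" by (simp add: invertible_det_nz det_zero_row)
next
  fix A :: "real^'n^'n" assume d: "\<And>i j. i \<noteq> j \<Longrightarrow> A $ i $ j = 0" and inv: "invertible A"
  obtain k where k: "lborel_scaling A k" using lborel_scaling_exists[OF inv] by blast
  \<comment> \<open>\<open>e\<close> lists the half-widths of the image of the cube
    \<open>?I\<close>, whose side is 2.\<close>
  define e where "e = (\<chi> i. \<bar>A $ i $ i\<bar>)"
  let ?I = "cbox (\<chi> i. -1) (\<chi> i. 1) :: (real^'n) set"
  have det: "det A = (\<Prod>i\<in>UNIV. A $ i $ i)" by (rule det_diagonal) (use d in auto)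
  then have nz: "A $ i $ i \<noteq> 0" for i using inv by (auto simp: invertible_det_nz)
  have A: "(A *v x) $ i = A $ i $ i * x $ i" for x i
  proof -
    have "(A *v x) $ i = (\<Sum>j\<in>UNIV. if j = i then A $ i $ i * x $ i else 0)"
      unfolding matrix_vector_mult_def vec_lambda_beta by (rule sum.cong) (auto simp: d)
    then show ?thesis by simp
  qed
  have vim: "(*v) A -` cbox (- e) e = ?I"
  proof -
    have "\<bar>A $ i $ i * t\<bar> \<le> \<bar>A $ i $ i\<bar> \<longleftrightarrow> \<bar>t\<bar> \<le> 1" for t i
      using nz[of i] by (simp add: abs_mult)
    then have "- \<bar>A $ i $ i\<bar> \<le> A $ i $ i * t \<and> A $ i $ i * t \<le> \<bar>A $ i $ i\<bar> \<longleftrightarrow> - 1 \<le> t \<and> t \<le> 1" for t i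
      by (metis abs_le_iff minus_le_iff)
    then show ?thesis by (simp add: set_eq_iff mem_box_cart A e_def)
  qed
  have "emeasure lborel ?I = ennreal k * emeasure lborel (cbox (- e) e)"
    using k borel_closed[OF closed_cbox, of "- e" e] unfolding lborel_scaling_def vim[symmetric] by blast
  then have "measure lborel ?I = k * measure lborel (cbox (- e) e)"
    using k by (simp add: measure_def enn2real_mult lborel_scaling_def)
  moreover have "measure lborel (cbox (- e) e) = 2 ^ CARD('n) * \<bar>det A\<bar>"
    by (subst content_cbox_cart)
      (auto simp: interval_ne_empty_cart e_def det abs_prod prod.distrib simp flip: mult_2)
  moreover have "measure lborel ?I = 2 ^ CARD('n)"
    by (subst content_cbox_cart) (auto simp: interval_ne_empty_cart)
  ultimately have "k * \<bar>det A\<bar> = 1" by simp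
  then have "k = 1 / \<bar>det A\<bar>" by (metis mult_zero_right nonzero_eq_divide_eq zero_neq_one)
  with k show "lborel_scaling A (1 / \<bar>det A\<bar>)" by simp
next
  fix m n :: 'n assume "m \<noteq> n"
  let ?W = "(\<chi> i j. mat 1 $ i $ Transposition.transpose m n j) :: real^'n^'n"
  assume inv: "invertible ?W"
  obtain k where k: "lborel_scaling ?W k" using lborel_scaling_exists[OF inv] by blast
  have W: "(?W *v x) $ i = x $ Transposition.transpose m n i" for x i
  proof -
    have "(?W *v x) $ i = (\<Sum>j\<in>UNIV. if j = Transposition.transpose m n i then x $ j else 0)"
      unfolding matrix_vector_mult_def vec_lambda_beta by (rule sum.cong) (auto simp: mat_def)
    then show ?thesis by simp
  qed
  have WW: "?W ** ?W = mat 1"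
    by (subst matrix_eq) (simp add: vec_eq_iff W flip: matrix_vector_mul_assoc)
  have "lborel_scaling (mat 1 :: real^'n^'n) 1" by (simp add: lborel_scaling_def vimage_def)
  with lborel_scaling_mult[OF k k] have "k * k = 1"
    unfolding WW by (rule lborel_scaling_unique)
  moreover have "k > 0" using k by (simp add: lborel_scaling_def)
  ultimately have "k = 1" by (metis abs_of_pos abs_square_eq_1 power2_eq_square)
  have "det ?W * det ?W = 1" using det_mul[of ?W ?W] by (simp add: WW)
  then have "\<bar>det ?W\<bar> = 1" by (metis abs_square_eq_1 power2_eq_square)
  with k \<open>k = 1\<close> show "lborel_scaling ?W (1 / \<bar>det ?W\<bar>)" by simp
next
  fix m n :: 'n assume mn: "m \<noteq> n"
  let ?S = "(\<chi> i j. of_bool (i = m \<and> j = n \<or> i = j)) :: real^'n^'n"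
  \<comment> \<open>\<open>?D\<close> doubles coordinate \<open>m\<close>; conjugation by it doubles
    the off-diagonal entry of the shear, which is also the effect of squaring the shear.\<close>
  let ?D = "(\<chi> i j. if i = j then if i = m then 2 else 1 else 0) :: real^'n^'n"
  assume inv: "invertible ?S"
  have "det ?D = (\<Prod>i\<in>UNIV. ?D $ i $ i)" by (rule det_diagonal) auto
  then have D0: "det ?D \<noteq> 0" by simp
  obtain k where k: "lborel_scaling ?S k" using lborel_scaling_exists[OF inv] by blast
  obtain l where l: "lborel_scaling ?D l"
    using lborel_scaling_exists[of ?D] D0 by (auto simp: invertible_det_nz)
  have S: "(?S *v x) $ i = (if i = m then x $ m + x $ n else x $ i)" for x i
  proof -
    have "(?S *v x) $ i = (\<Sum>j\<in>UNIV. (if j = i then x $ j else 0)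
        + (if j = n then if i = m then x $ j else 0 else 0))"
      unfolding matrix_vector_mult_def vec_lambda_beta by (rule sum.cong) (use mn in auto)
    then show ?thesis by (simp add: sum.distrib)
  qed
  have D: "(?D *v x) $ i = (if i = m then 2 * x $ i else x $ i)" for x i
  proof -
    have "(?D *v x) $ i = (\<Sum>j\<in>UNIV. if j = i then if i = m then 2 * x $ j else x $ j else 0)"
      unfolding matrix_vector_mult_def vec_lambda_beta by (rule sum.cong) auto
    then show ?thesis by simp
  qed
  \<comment> \<open>A shear is conjugate to its own square, so any positive multiplicative invariant of it is \<open>1\<close>.\<close>
  have conj: "?D ** ?S = ?S ** ?S ** ?D"
    unfolding matrix_eq vec_eq_iff matrix_vector_mul_assoc[symmetric] S D using mn by auto
  have "l * k = k * k * l"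
    using lborel_scaling_mult[OF l k] lborel_scaling_mult[OF lborel_scaling_mult[OF k k] l]
    unfolding conj by (rule lborel_scaling_unique)
  then have "k = 1" using k l by (simp add: lborel_scaling_def)
  have "det ?D * det ?S = det ?S * det ?S * det ?D"
    using arg_cong[OF conj, of det] by (simp only: det_mul)
  then have "det ?S = 1" using D0 inv by (simp add: invertible_det_nz)
  with k \<open>k = 1\<close> show "lborel_scaling ?S (1 / \<bar>det ?S\<bar>)" by simp
qed

text \<open>In this form Gaussian laws can be transported by the algebra of \<open>density\<close>
  and \<open>distr\<close> alone.\<close>

lemma lborel_linear:
  fixes A :: "real^'n^'n"
  assumes inv: "invertible A"
  shows "density (distr lborel borel ((*v) A)) (\<lambda>_. ennreal \<bar>det A\<bar>) = lborel"
proof (rule measure_eqI)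
  fix F assume "F \<in> sets (density (distr lborel borel ((*v) A)) (\<lambda>_. ennreal \<bar>det A\<bar>))"
  then have F: "F \<in> sets borel" by simp
  have "\<bar>det A\<bar> > 0" using inv by (simp add: invertible_det_nz)
  then have "ennreal \<bar>det A\<bar> * (ennreal (1 / \<bar>det A\<bar>) * emeasure lborel F) = emeasure lborel F"
    by (simp add: mult.assoc[symmetric] ennreal_mult[symmetric])
  then show "emeasure (density (distr lborel borel ((*v) A)) (\<lambda>_. ennreal \<bar>det A\<bar>)) F = emeasure lborel F"
    using F lborel_scaling_det[OF inv] by (simp add: emeasure_density_const emeasure_distr lborel_scaling_def)
qed simp

lemma lborel_affine_matrix:
  fixes A :: "real^'n^'n"
  assumes inv: "invertible A"
  shows "density (distr lborel borel (\<lambda>x. v + A *v (x - u))) (\<lambda>_. ennreal \<bar>det A\<bar>) = lborel"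
proof -
  define c where "c = v - A *v u"
  have "(\<lambda>x. v + A *v (x - u)) = (+) c \<circ> (*v) A"
    by (auto simp: c_def matrix_vector_mult_diff_distrib)
  then have "distr lborel borel (\<lambda>x. v + A *v (x - u)) = distr (distr lborel borel ((*v) A)) borel ((+) c)"
    by (simp add: distr_distr)
  then have "density (distr lborel borel (\<lambda>x. v + A *v (x - u))) (\<lambda>_. ennreal \<bar>det A\<bar>)
      = distr (density (distr lborel borel ((*v) A)) (\<lambda>_. ennreal \<bar>det A\<bar>)) borel ((+) c)"
    by (simp add: density_distr)
  then show ?thesis by (simp add: lborel_linear[OF inv] lborel_distr_plus)
qed

lemma sets_gaussian [simp, measurable_cong]: "sets (gaussian m \<Sigma>) = sets borel"
  by (simp add: gaussian_def)

lemma space_gaussian [simp]: "space (gaussian m \<Sigma>) = UNIV"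
  by (simp add: gaussian_def)

text \<open>The map carries one quadratic exponent to the other, and
  \<open>\<bar>det L\<bar>\<close> is the ratio of the normalising factors. It serves twice: to
  reduce to the standard Gaussian, and to identify the second marginal of the coupling.\<close>

lemma gaussian_distr_affine:
  fixes L P :: "real^'n^'n"
  assumes P: "sym_posdef P" and L: "invertible L"
  shows "distr (gaussian u P) borel (\<lambda>x. v + L *v (x - u)) = gaussian v (L ** P ** transpose L)"
proof -
  define Q where "Q = L ** P ** transpose L"
  define T where "T x = v + L *v (x - u)" for x
  define g where "g y = exp (- ((y - v) \<bullet> (matrix_inv Q *v (y - v))) / 2)
                    / sqrt ((2 * pi) ^ CARD('n) * det Q)" for y
  define f where "f x = exp (- ((x - u) \<bullet> (matrix_inv P *v (x - u))) / 2)
                    / sqrt ((2 * pi) ^ CARD('n) * det P)" for x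
  have [measurable]: "T \<in> borel_measurable borel" "g \<in> borel_measurable borel" "f \<in> borel_measurable borel"
    unfolding T_def g_def f_def by measurable
  note invP = sym_posdef_invertible[OF P]
  have invT: "transpose L ** transpose (matrix_inv L) = mat 1"
    by (metis L matrix_mul_inv(2) matrix_transpose_mul transpose_mat)
  have "Q ** (transpose (matrix_inv L) ** matrix_inv P ** matrix_inv L)
      = L ** (P ** ((transpose L ** transpose (matrix_inv L)) ** matrix_inv P)) ** matrix_inv L"
    by (simp add: Q_def matrix_mul_assoc)
  also have "\<dots> = mat 1" by (simp add: invT matrix_mul_inv[OF L] matrix_mul_inv[OF invP])
  finally have Qi: "matrix_inv Q = transpose (matrix_inv L) ** matrix_inv P ** matrix_inv L"
    by (rule matrix_inv_eqI)
  have quad: "(T x - v) \<bullet> (matrix_inv Q *v (T x - v)) = (x - u) \<bullet> (matrix_inv P *v (x - u))" for x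
  proof -
    have "matrix_inv Q *v (T x - v) = transpose (matrix_inv L) *v (matrix_inv P *v (x - u))"
      by (simp add: T_def Qi matrix_inv_vector[OF L] flip: matrix_vector_mul_assoc)
    moreover have "(L *v y) \<bullet> (transpose (matrix_inv L) *v w) = y \<bullet> w" for y w
      using dot_lmul_matrix[of w "matrix_inv L" "L *v y"]
      by (simp add: matrix_inv_vector[OF L] inner_commute)
    ultimately show ?thesis by (simp add: T_def)
  qed
  have dL: "\<bar>det L\<bar> > 0" using L by (simp add: invertible_det_nz)
  have dP: "det P > 0" by (rule det_posdef_pos[OF P])
  have "det Q = (det L)\<^sup>2 * det P" by (simp add: Q_def det_mul power2_eq_square)
  then have sq: "sqrt ((2 * pi) ^ CARD('n) * det Q) = \<bar>det L\<bar> * sqrt ((2 * pi) ^ CARD('n) * det P)"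
    by (simp add: real_sqrt_mult)
  have fg: "\<bar>det L\<bar> * g (T x) = f x" for x
    unfolding g_def f_def quad sq using dL by simp
  have "gaussian v Q = density (density (distr lborel borel T) (\<lambda>_. ennreal \<bar>det L\<bar>)) g"
    using lborel_affine_matrix[OF L, of v u] by (simp only: gaussian_def g_def T_def[abs_def])
  also have "\<dots> = density (distr lborel borel T) (\<lambda>y. ennreal \<bar>det L\<bar> * ennreal (g y))"
    by (rule density_density_eq) auto
  also have "\<dots> = distr (density lborel (\<lambda>x. ennreal \<bar>det L\<bar> * ennreal (g (T x)))) borel T"
    by (rule density_distr) auto
  also have "(\<lambda>x. ennreal \<bar>det L\<bar> * ennreal (g (T x))) = (\<lambda>x. ennreal (f x))"
    by (auto simp: fg ennreal_mult'[symmetric])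
  finally show ?thesis by (simp add: gaussian_def f_def T_def Q_def)
qed

lemma gaussian_std_density_prod:
  fixes x :: "real^'n"
  shows "exp (- ((x - 0) \<bullet> (matrix_inv (mat 1) *v (x - 0))) / 2) / sqrt ((2 * pi) ^ CARD('n) * det (mat 1 :: real^'n^'n))
    = (\<Prod>b\<in>Basis. std_normal_density (x \<bullet> b))"
proof -
  have inv1: "matrix_inv (mat 1 :: real^'n^'n) = mat 1" by (rule matrix_inv_eqI) simp
  have "(\<Prod>b\<in>Basis. std_normal_density (x \<bullet> b))
      = (\<Prod>b\<in>(Basis :: (real^'n) set). 1 / sqrt (2 * pi)) * (\<Prod>b\<in>Basis. exp (- (x \<bullet> b)\<^sup>2 / 2))"
    by (subst prod.distrib[symmetric]) (simp add: normal_density_def)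
  also have "(\<Prod>b\<in>Basis. exp (- (x \<bullet> b)\<^sup>2 / 2)) = exp (- (x \<bullet> x) / 2)"
    by (simp add: exp_sum[symmetric] euclidean_inner[of x x] power2_eq_square sum_negf sum_divide_distrib)
  also have "(\<Prod>b\<in>(Basis :: (real^'n) set). 1 / sqrt (2 * pi)) = 1 / sqrt ((2 * pi) ^ CARD('n))"
    by (simp add: power_one_over real_sqrt_power[symmetric] power_mult_distrib)
  finally show ?thesis by (simp add: inv1)
qed

text \<open>The standard density factorises over coordinates. Constant factors \<open>1\<close> give
  the total mass; a square in one coordinate gives the second moments.\<close>

lemma nn_integral_gaussian_std:
  fixes h :: "(real^'n) \<Rightarrow> real \<Rightarrow> ennreal"
  assumes [measurable]: "\<And>b. b \<in> Basis \<Longrightarrow> h b \<in> borel_measurable borel"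
  shows "(\<integral>\<^sup>+x. (\<Prod>b\<in>Basis. h b (x \<bullet> b)) \<partial>gaussian (0::real^'n) (mat 1))
    = (\<Prod>b\<in>Basis. \<integral>\<^sup>+t. ennreal (std_normal_density t) * h b t \<partial>lborel)"
proof -
  have "(\<integral>\<^sup>+x. (\<Prod>b\<in>Basis. h b (x \<bullet> b)) \<partial>gaussian (0::real^'n) (mat 1))
      = (\<integral>\<^sup>+x. ennreal (\<Prod>b\<in>Basis. std_normal_density (x \<bullet> b)) * (\<Prod>b\<in>Basis. h b (x \<bullet> b)) \<partial>lborel)"
    unfolding gaussian_def gaussian_std_density_prod by (rule nn_integral_density) measurable
  also have "\<dots> = (\<integral>\<^sup>+x. (\<Prod>b\<in>Basis. ennreal (std_normal_density (x \<bullet> b)) * h b (x \<bullet> b)) \<partial>lborel)"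
    by (simp add: prod.distrib prod_ennreal)
  also have "\<dots> = (\<Prod>b\<in>Basis. \<integral>\<^sup>+t. ennreal (std_normal_density t) * h b t \<partial>lborel)"
    by (rule nn_integral_lborel_prod) auto
  finally show ?thesis .
qed

lemma nn_integral_std_normal_density: "(\<integral>\<^sup>+t. ennreal (std_normal_density t) \<partial>lborel) = 1"
  using std_normal_moment_even[of 0] by (simp add: nn_integral_eq_integral has_bochner_integral_iff)

lemma gaussian_std_prob_space: "prob_space (gaussian (0::real^'n) (mat 1))"
  using nn_integral_gaussian_std[of "\<lambda>_ _. 1"]
  by (intro prob_spaceI) (simp add: nn_integral_std_normal_density)

lemma gaussian_std_second_moment: "integrable (gaussian (0::real^'n) (mat 1)) (\<lambda>x. (norm x)\<^sup>2)"
proof -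
  have "integrable (gaussian (0::real^'n) (mat 1)) (\<lambda>x. (x \<bullet> b)\<^sup>2)" if b: "b \<in> Basis" for b
  proof (rule integrableI_nonneg)
    have "(\<integral>\<^sup>+x. ennreal ((x \<bullet> b)\<^sup>2) \<partial>gaussian (0::real^'n) (mat 1))
        = (\<integral>\<^sup>+x. (\<Prod>b'\<in>Basis. if b' = b then ennreal ((x \<bullet> b')\<^sup>2) else 1) \<partial>gaussian (0::real^'n) (mat 1))"
      using b by (simp add: prod.delta)
    also have "\<dots> = (\<Prod>b'\<in>(Basis::(real^'n) set). \<integral>\<^sup>+t. ennreal (std_normal_density t) * (if b' = b then ennreal (t\<^sup>2) else 1) \<partial>lborel)"
      by (rule nn_integral_gaussian_std) measurable
    also have "\<dots> < \<infinity>"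
    proof -
      have "(\<integral>\<^sup>+t. ennreal (std_normal_density t) * ennreal (t\<^sup>2) \<partial>lborel) = 1"
        using std_normal_moment_even[of 1]
        by (simp add: nn_integral_eq_integral has_bochner_integral_iff ennreal_mult[symmetric])
      then have "(\<integral>\<^sup>+t. ennreal (std_normal_density t) * (if b' = b then ennreal (t\<^sup>2) else 1) \<partial>lborel) = 1" for b'
        by (cases "b' = b") (simp_all add: nn_integral_std_normal_density)
      then show ?thesis by simp
    qed
    finally show "(\<integral>\<^sup>+x. ennreal ((x \<bullet> b)\<^sup>2) \<partial>gaussian (0::real^'n) (mat 1)) < \<infinity>" .
  qed auto
  then have "integrable (gaussian (0::real^'n) (mat 1)) (\<lambda>x. \<Sum>b\<in>Basis. (x \<bullet> b)\<^sup>2)"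
    by (intro Bochner_Integration.integrable_sum)
  then show ?thesis
    unfolding power2_norm_eq_inner by (subst euclidean_inner) (simp add: power2_eq_square)
qed

text \<open>Carries total mass and second moments from the standard law to every nondegenerate
  one.\<close>

lemma gaussian_eq_distr_std:
  fixes \<Sigma> :: "real^'n^'n"
  assumes "sym_posdef \<Sigma>"
  shows "gaussian m \<Sigma> = distr (gaussian 0 (mat 1)) borel (\<lambda>x. m + mat_sqrt \<Sigma> *v x)"
proof -
  note R = mat_sqrt_posdef[OF assms]
  have "transpose (mat_sqrt \<Sigma>) = mat_sqrt \<Sigma>" using R by (simp add: sym_posdef_def)
  then show ?thesis
    using gaussian_distr_affine[OF sym_posdef_mat_1 sym_posdef_invertible[OF R(1)], of 0 m] R by simp
qed

lemma prob_space_gaussian: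
  fixes \<Sigma> :: "real^'n^'n"
  assumes "sym_posdef \<Sigma>"
  shows "prob_space (gaussian m \<Sigma>)"
  unfolding gaussian_eq_distr_std[OF assms, of m]
  by (rule prob_space.prob_space_distr[OF gaussian_std_prob_space]) measurable

lemma norm_add_squared_le: "(norm (a + b))\<^sup>2 \<le> 2 * (norm a)\<^sup>2 + 2 * (norm b)\<^sup>2"
  for a b :: "'a::real_normed_vector"
proof -
  have "(norm (a + b))\<^sup>2 \<le> (norm a + norm b)\<^sup>2" by (simp add: norm_triangle_ineq power_mono)
  also have "\<dots> \<le> 2 * (norm a)\<^sup>2 + 2 * (norm b)\<^sup>2"
    using sum_squares_bound[of "norm a" "norm b"] by (simp add: power2_sum)
  finally show ?thesis .
qed

lemma gaussian_second_moment:
  fixes \<Sigma> :: "real^'n^'n"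
  assumes "sym_posdef \<Sigma>"
  shows "integrable (gaussian m \<Sigma>) (\<lambda>x. (norm x)\<^sup>2)"
proof -
  let ?G = "gaussian (0::real^'n) (mat 1)" and ?R = "mat_sqrt \<Sigma>"
  interpret prob_space ?G by (rule gaussian_std_prob_space)
  obtain K where K: "\<And>x. norm (?R *v x) \<le> norm x * K"
    using bounded_linear.bounded[OF matrix_vector_mul_bounded_linear[of ?R]] by blast
  have le: "(norm (m + ?R *v x))\<^sup>2 \<le> 2 * (norm m)\<^sup>2 + 2 * (K\<^sup>2 * (norm x)\<^sup>2)" for x
  proof -
    have "(norm (?R *v x))\<^sup>2 \<le> K\<^sup>2 * (norm x)\<^sup>2"
      using power_mono[OF K norm_ge_zero, of x 2] by (simp add: power_mult_distrib mult.commute)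
    then show ?thesis using norm_add_squared_le[of m "?R *v x"] by linarith
  qed
  have "integrable ?G (\<lambda>x. 2 * (norm m)\<^sup>2 + 2 * (K\<^sup>2 * (norm x)\<^sup>2))"
    using gaussian_std_second_moment by auto
  then have "integrable ?G (\<lambda>x. (norm (m + ?R *v x))\<^sup>2)"
    by (rule Bochner_Integration.integrable_bound) (use le in auto)
  then show ?thesis
    unfolding gaussian_eq_distr_std[OF assms, of m] by (subst integrable_distr_eq) auto
qed

lemma integrable_quadratic_growth:
  fixes f :: "'a::euclidean_space \<Rightarrow> real"
  assumes "finite_measure M" "integrable M (\<lambda>x. (norm x)\<^sup>2)" "f \<in> borel_measurable M"
    and "\<And>x. \<bar>f x\<bar> \<le> C * (1 + (norm x)\<^sup>2)"
  shows "integrable M f"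
proof -
  have "integrable M (\<lambda>x. C * (1 + (norm x)\<^sup>2))"
    using assms(1,2) by (simp add: finite_measure.integrable_const)
  then show ?thesis
    by (rule Bochner_Integration.integrable_bound) (use assms in \<open>auto intro!: AE_I2 order_trans[OF _ abs_ge_self]\<close>)
qed

text \<open>The powers of \<open>2 * pi\<close> cancel and the determinants are moved into the
  exponent, so the density takes the shape \<open>exp (- \<phi> x / \<tau>)\<close> with a quadratic
  \<open>\<phi>\<close>, as complementary slackness demands.\<close>

lemma gaussian_density_ratio:
  fixes P \<Sigma> :: "real^'n^'n"
  assumes P: "sym_posdef P" and \<Sigma>: "sym_posdef \<Sigma>"
  shows "gaussian u P = density (gaussian m \<Sigma>)
    (\<lambda>x. ennreal (exp (((x - m) \<bullet> (matrix_inv \<Sigma> *v (x - m)) - (x - u) \<bullet> (matrix_inv P *v (x - u))) / 2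
       + ln (det \<Sigma> / det P) / 2)))"
proof -
  have d: "det P > 0" "det \<Sigma> > 0" using P \<Sigma> by (simp_all add: det_posdef_pos)
  have "exp (ln (det \<Sigma> / det P) / 2) = sqrt (det \<Sigma> / det P)"
    using d powr_half_sqrt[of "det \<Sigma> / det P"] by (simp add: powr_def)
  then have r: "exp ((X - Y) / 2 + ln (det \<Sigma> / det P) / 2)
      = exp (X / 2) / exp (Y / 2) * (sqrt (det \<Sigma>) / sqrt (det P))" for X Y
    by (simp add: exp_add exp_diff diff_divide_distrib real_sqrt_divide)
  have *: "exp (- X / 2) / sqrt ((2 * pi) ^ CARD('n) * det \<Sigma>) * exp ((X - Y) / 2 + ln (det \<Sigma> / det P) / 2)
      = exp (- Y / 2) / sqrt ((2 * pi) ^ CARD('n) * det P)" for X Y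
    unfolding r real_sqrt_mult using d by (simp add: exp_minus field_simps)
  have [measurable]: "(\<lambda>x. ennreal (exp (((x - m) \<bullet> (matrix_inv \<Sigma> *v (x - m)) - (x - u) \<bullet> (matrix_inv P *v (x - u))) / 2
       + ln (det \<Sigma> / det P) / 2))) \<in> borel_measurable lborel"
    by measurable
  show ?thesis
    unfolding gaussian_def
    by (subst density_density_eq, measurable) (simp only: ennreal_mult''[symmetric] exp_ge_zero *)
qed

subsection \<open>Duality for the unbalanced problem\<close>

lemma kl_young:
  fixes r s :: real
  assumes "r \<ge> 0" "s > 0"
  shows "0 \<le> r * ln r - r - r * ln s + s"
    and "r * ln r - r - r * ln s + s = 0 \<longleftrightarrow> r = s"
proof -
  have "0 \<le> r * ln r - r - r * ln s + s \<and> (r * ln r - r - r * ln s + s = 0 \<longleftrightarrow> r = s)"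
  proof (cases "r = 0")
    case False
    with assms have r: "r > 0" by simp
    have eq: "r * ln r - r - r * ln s + s = r * (s / r - 1 - ln (s / r))"
      using r assms by (simp add: ln_div algebra_simps)
    have "ln (s / r) \<le> s / r - 1" using r assms by (intro ln_le_minus_one) simp
    moreover have "s / r = 1" if "s / r - 1 - ln (s / r) = 0"
      using that r assms by (intro ln_eq_minus_one) auto
    moreover have "r = s" if "s / r = 1" using that r by simp
    ultimately show ?thesis unfolding eq using r assms by auto
  qed (use assms in auto)
  then show "0 \<le> r * ln r - r - r * ln s + s" "r * ln r - r - r * ln s + s = 0 \<longleftrightarrow> r = s"
    by blast+
qed

lemma kl_nonneg: "r \<ge> 0 \<Longrightarrow> 0 \<le> r * ln r - r + (1::real)"
  using kl_young(1)[of r 1] by simp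

text \<open>\<open>RN_deriv\<close> is determined almost everywhere, so an explicit density may
  replace it under the integral.\<close>

lemma gen_KL_density:
  assumes "finite_measure \<eta>" and [measurable]: "s \<in> borel_measurable \<eta>" and s: "\<And>x. s x \<ge> (0::real)"
  shows "gen_KL (density \<eta> s) \<eta> = (\<integral>\<^sup>+x. ennreal (s x * ln (s x) - s x + 1) \<partial>\<eta>)"
proof -
  interpret finite_measure \<eta> by fact
  have "AE x in \<eta>. ennreal (s x) = RN_deriv \<eta> (density \<eta> s) x"
    by (rule RN_deriv_unique) auto
  then have "AE x in \<eta>. enn2real (RN_deriv \<eta> (density \<eta> s) x) = s x"
    by eventually_elim (metis enn2real_ennreal s)
  then have "(\<integral>\<^sup>+x. (let r = enn2real (RN_deriv \<eta> (density \<eta> s) x) in ennreal (r * ln r - r + 1)) \<partial>\<eta>)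
      = (\<integral>\<^sup>+x. ennreal (s x * ln (s x) - s x + 1) \<partial>\<eta>)"
    by (intro nn_integral_cong_AE) (auto simp: Let_def)
  then show ?thesis
    unfolding gen_KL_def by (simp add: absolutely_continuousI_density)
qed

text \<open>A finite divergence forces absolute continuity, and finiteness of \<open>\<rho>\<close>
  makes the derivative finite almost everywhere, so it has a real-valued version.\<close>

lemma gen_KL_finite_density:
  assumes "finite_measure \<eta>" "finite_measure \<rho>" "sets \<rho> = sets \<eta>" and fin: "gen_KL \<rho> \<eta> < \<infinity>"
  obtains r where "r \<in> borel_measurable \<eta>" "\<And>x. r x \<ge> (0::real)" "\<rho> = density \<eta> (\<lambda>x. ennreal (r x))"
proof -
  interpret \<eta>: finite_measure \<eta> by fact
  interpret \<rho>: finite_measure \<rho> by fact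
  have ac: "absolutely_continuous \<eta> \<rho>" using fin by (auto simp: gen_KL_def split: if_splits)
  define r where "r x = enn2real (RN_deriv \<eta> \<rho> x)" for x
  have "AE x in \<eta>. RN_deriv \<eta> \<rho> x \<noteq> \<infinity>"
    by (rule \<eta>.RN_deriv_finite[OF \<rho>.sigma_finite_measure_axioms ac assms(3)])
  then have "AE x in \<eta>. RN_deriv \<eta> \<rho> x = ennreal (r x)"
    by eventually_elim (simp add: r_def less_top)
  then have "density \<eta> (RN_deriv \<eta> \<rho>) = density \<eta> (\<lambda>x. ennreal (r x))"
    by (intro density_cong) (auto simp: r_def)
  moreover have "density \<eta> (RN_deriv \<eta> \<rho>) = \<rho>" by (rule \<eta>.density_RN_deriv[OF ac assms(3)])
  moreover have "r \<in> borel_measurable \<eta>" unfolding r_def by measurable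
  ultimately show thesis by (intro that[of r]) (auto simp: r_def)
qed

lemma finite_measure_density_integrable:
  assumes "finite_measure (density M (\<lambda>x. ennreal (s x)))" "s \<in> borel_measurable M" "\<And>x. s x \<ge> (0::real)"
  shows "integrable M s" "(\<integral>x. s x \<partial>M) = measure (density M s) (space M)"
proof -
  have e: "(\<integral>\<^sup>+x. ennreal (s x) \<partial>M) = emeasure (density M s) (space M)"
    using assms(2) by (simp add: emeasure_density cong: nn_integral_cong)
  also have "\<dots> < \<infinity>"
    using finite_measure.emeasure_finite[OF assms(1)] by (simp add: less_top)
  finally show "integrable M s" using assms by (intro integrableI_nonneg) auto
  then show "(\<integral>x. s x \<partial>M) = measure (density M s) (space M)"
    using e assms by (simp add: integral_eq_nn_integral measure_def)
qed

text \<open>The negative part of \<open>\<phi>\<close> is controlled by Young's inequality.  For the positive part one needs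
  the constraint \<open>\<phi> x + \<psi> y \<le> \<parallel>x - y\<parallel>\<^sup>2\<close>, so integrability of \<open>\<phi>\<close> is a separate assumption here.\<close>

lemma gen_KL_gap:
  assumes \<alpha>: "finite_measure \<alpha>" and \<rho>: "finite_measure \<rho>" "sets \<rho> = sets \<alpha>" and \<tau>: "\<tau> > 0"
    and \<phi> [measurable]: "\<phi> \<in> borel_measurable \<alpha>"
    and int: "integrable \<alpha> (\<lambda>x. exp (- \<phi> x / \<tau>))"
    and fin: "gen_KL \<rho> \<alpha> < \<infinity>"
  shows "integrable \<rho> (\<lambda>x. max 0 (- \<phi> x))"
    and "integrable \<rho> \<phi> \<Longrightarrow>
      \<tau> * (measure \<alpha> (space \<alpha>) - (\<integral>x. exp (- \<phi> x / \<tau>) \<partial>\<alpha>)) \<le> \<tau> * enn2real (gen_KL \<rho> \<alpha>) + (\<integral>x. \<phi> x \<partial>\<rho>)"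
    and "integrable \<rho> \<phi> \<Longrightarrow>
      \<tau> * (measure \<alpha> (space \<alpha>) - (\<integral>x. exp (- \<phi> x / \<tau>) \<partial>\<alpha>)) = \<tau> * enn2real (gen_KL \<rho> \<alpha>) + (\<integral>x. \<phi> x \<partial>\<rho>) \<Longrightarrow>
      \<rho> = density \<alpha> (\<lambda>x. ennreal (exp (- \<phi> x / \<tau>)))"
proof -
  interpret finite_measure \<alpha> by fact
  obtain r where r [measurable]: "r \<in> borel_measurable \<alpha>" and r0: "\<And>x. r x \<ge> 0"
    and \<rho>r: "\<rho> = density \<alpha> (\<lambda>x. ennreal (r x))"
    using gen_KL_finite_density[OF \<alpha> \<rho> fin] by blast
  let ?s = "\<lambda>x. exp (- \<phi> x / \<tau>)"
  let ?k = "\<lambda>x. r x * ln (r x) - r x + 1"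
  \<comment> \<open>\<open>?G\<close> is the pointwise gap in Young's inequality;
    \<open>\<tau>\<close> times its integral is the whole slack in the claimed bound.\<close>
  let ?G = "\<lambda>x. r x * ln (r x) - r x - r x * ln (?s x) + ?s x"
  have kl: "gen_KL \<rho> \<alpha> = (\<integral>\<^sup>+x. ennreal (?k x) \<partial>\<alpha>)"
    unfolding \<rho>r by (rule gen_KL_density[OF \<alpha> r r0])
  have intk: "integrable \<alpha> ?k"
    using fin r0 unfolding kl by (intro integrableI_nonneg) (auto simp: kl_nonneg)
  have KL: "enn2real (gen_KL \<rho> \<alpha>) = (\<integral>x. ?k x \<partial>\<alpha>)"
    unfolding kl using r0 by (intro integral_eq_nn_integral[symmetric]) (auto simp: kl_nonneg)
  have G0: "?G x \<ge> 0" for x by (rule kl_young(1)[OF r0]) simp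
  have "integrable \<alpha> (\<lambda>x. r x * max 0 (- \<phi> x))"
  proof (rule Bochner_Integration.integrable_bound)
    show "integrable \<alpha> (\<lambda>x. \<tau> * (?k x + ?s x))" using intk int by auto
    have "r x * max 0 (- \<phi> x) \<le> \<tau> * (?k x + ?s x)" for x
    proof (cases "\<phi> x < 0")
      case True
      have "r x * (- \<phi> x / \<tau>) \<le> ?k x + ?s x" using G0[of x] by simp
      then show ?thesis using \<tau> True by (simp add: field_simps)
    next
      case False
      then show ?thesis using \<tau> kl_nonneg[OF r0] by (simp add: add_nonneg_nonneg)
    qed
    then show "AE x in \<alpha>. norm (r x * max 0 (- \<phi> x)) \<le> norm (\<tau> * (?k x + ?s x))"
      using r0 by (intro AE_I2) (metis abs_ge_self abs_of_nonneg max.cobounded1 mult_nonneg_nonneg order_trans real_norm_def)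
  qed auto
  then show "integrable \<rho> (\<lambda>x. max 0 (- \<phi> x))"
    unfolding \<rho>r using r0 by (subst integrable_density) auto
  have gap: "\<tau> * enn2real (gen_KL \<rho> \<alpha>) + (\<integral>x. \<phi> x \<partial>\<rho>)
      = \<tau> * (measure \<alpha> (space \<alpha>) - (\<integral>x. ?s x \<partial>\<alpha>)) + \<tau> * (\<integral>x. ?G x \<partial>\<alpha>)"
    and intG: "integrable \<alpha> ?G" if "integrable \<rho> \<phi>"
  proof -
    have int\<phi>: "integrable \<alpha> (\<lambda>x. r x * \<phi> x)" and I\<phi>: "(\<integral>x. \<phi> x \<partial>\<rho>) = (\<integral>x. r x * \<phi> x \<partial>\<alpha>)"
      using that r0 unfolding \<rho>r by (simp_all add: integrable_density integral_density)
    have G: "?G = (\<lambda>x. ?k x + (r x * \<phi> x / \<tau> + (?s x - 1)))"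
      by (auto simp: field_simps)
    show "integrable \<alpha> ?G" unfolding G
      by (intro Bochner_Integration.integrable_add Bochner_Integration.integrable_diff intk int
          integrable_divide_zero int\<phi> integrable_const)
    have "(\<integral>x. ?G x \<partial>\<alpha>) = (\<integral>x. ?k x \<partial>\<alpha>) + ((\<integral>x. r x * \<phi> x \<partial>\<alpha>) / \<tau> + ((\<integral>x. ?s x \<partial>\<alpha>) - measure \<alpha> (space \<alpha>)))"
      unfolding G
      by (subst Bochner_Integration.integral_add; (subst Bochner_Integration.integral_add)?)
        (use intk int\<phi> int in auto)
    then show "\<tau> * enn2real (gen_KL \<rho> \<alpha>) + (\<integral>x. \<phi> x \<partial>\<rho>)
      = \<tau> * (measure \<alpha> (space \<alpha>) - (\<integral>x. ?s x \<partial>\<alpha>)) + \<tau> * (\<integral>x. ?G x \<partial>\<alpha>)"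
      using \<tau> by (simp add: KL I\<phi> field_simps)
  qed
  have IG: "(\<integral>x. ?G x \<partial>\<alpha>) \<ge> 0" by (rule Bochner_Integration.integral_nonneg) (rule G0)
  show "\<tau> * (measure \<alpha> (space \<alpha>) - (\<integral>x. ?s x \<partial>\<alpha>)) \<le> \<tau> * enn2real (gen_KL \<rho> \<alpha>) + (\<integral>x. \<phi> x \<partial>\<rho>)"
    if "integrable \<rho> \<phi>"
    using gap[OF that] mult_nonneg_nonneg[of \<tau> "\<integral>x. ?G x \<partial>\<alpha>"] IG \<tau> by linarith
  show "\<rho> = density \<alpha> (\<lambda>x. ennreal (?s x))"
    if *: "integrable \<rho> \<phi>" and eq: "\<tau> * (measure \<alpha> (space \<alpha>) - (\<integral>x. ?s x \<partial>\<alpha>)) = \<tau> * enn2real (gen_KL \<rho> \<alpha>) + (\<integral>x. \<phi> x \<partial>\<rho>)"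
  proof -
    have "(\<integral>x. ?G x \<partial>\<alpha>) = 0" using gap[OF *] eq \<tau> by simp
    then have "AE x in \<alpha>. ?G x = 0"
      using integral_nonneg_eq_0_iff_AE[OF intG[OF *]] G0 by simp
    then have "AE x in \<alpha>. ennreal (r x) = ennreal (?s x)"
      by eventually_elim (use kl_young(2)[OF r0] in \<open>metis exp_gt_zero\<close>)
    then show ?thesis unfolding \<rho>r by (intro density_cong) auto
  qed
qed

text \<open>For this density the gap in Young's inequality is zero at every point, so the bound of
  \<open>gen_KL_gap\<close> is attained; the entropy integrand becomes an integrable expression in
  \<open>\<phi>\<close>.\<close>

lemma gen_KL_gap_attained:
  assumes \<alpha>: "finite_measure \<alpha>" and \<tau>: "\<tau> > 0"
    and \<phi> [measurable]: "\<phi> \<in> borel_measurable \<alpha>"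
    and \<rho>: "\<rho> = density \<alpha> (\<lambda>x. ennreal (exp (- \<phi> x / \<tau>)))"
    and fin: "finite_measure \<rho>" and int\<phi>: "integrable \<rho> \<phi>"
  shows "gen_KL \<rho> \<alpha> < \<infinity>"
    and "\<tau> * enn2real (gen_KL \<rho> \<alpha>) + (\<integral>x. \<phi> x \<partial>\<rho>)
      = \<tau> * (measure \<alpha> (space \<alpha>) - (\<integral>x. exp (- \<phi> x / \<tau>) \<partial>\<alpha>))"
proof -
  interpret finite_measure \<alpha> by fact
  let ?s = "\<lambda>x. exp (- \<phi> x / \<tau>)"
  let ?k = "\<lambda>x. ?s x * ln (?s x) - ?s x + 1"
  have kl: "gen_KL \<rho> \<alpha> = (\<integral>\<^sup>+x. ennreal (?k x) \<partial>\<alpha>)"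
    unfolding \<rho> by (rule gen_KL_density[OF \<alpha>]) auto
  have ints: "integrable \<alpha> ?s"
    using finite_measure_density_integrable(1)[of \<alpha> ?s] fin unfolding \<rho> by simp
  have int\<phi>': "integrable \<alpha> (\<lambda>x. ?s x * \<phi> x)" and I\<phi>: "(\<integral>x. \<phi> x \<partial>\<rho>) = (\<integral>x. ?s x * \<phi> x \<partial>\<alpha>)"
    using int\<phi> unfolding \<rho> by (simp_all add: integrable_density integral_density)
  have k: "?k = (\<lambda>x. - (?s x * \<phi> x / \<tau>) - (?s x - 1))" by (auto simp: field_simps)
  have intk: "integrable \<alpha> ?k" unfolding k using int\<phi>' ints by auto
  have nn: "?k x \<ge> 0" for x by (rule kl_nonneg) simp
  have kl': "gen_KL \<rho> \<alpha> = ennreal (\<integral>x. ?k x \<partial>\<alpha>)"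
    unfolding kl using intk nn by (intro nn_integral_eq_integral) auto
  then show "gen_KL \<rho> \<alpha> < \<infinity>" by simp
  have "(\<integral>x. ?k x \<partial>\<alpha>) = - ((\<integral>x. ?s x * \<phi> x \<partial>\<alpha>) / \<tau>) - ((\<integral>x. ?s x \<partial>\<alpha>) - measure \<alpha> (space \<alpha>))"
    unfolding k using int\<phi>' ints by simp
  moreover have "enn2real (gen_KL \<rho> \<alpha>) = (\<integral>x. ?k x \<partial>\<alpha>)"
    unfolding kl' using nn by (simp only: enn2real_ennreal Bochner_Integration.integral_nonneg)
  ultimately show "\<tau> * enn2real (gen_KL \<rho> \<alpha>) + (\<integral>x. \<phi> x \<partial>\<rho>)
      = \<tau> * (measure \<alpha> (space \<alpha>) - (\<integral>x. ?s x \<partial>\<alpha>))"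
    using \<tau> by (simp add: I\<phi> field_simps)
qed

lemma fst_snd_measurable_borel:
  "(fst :: 'a::euclidean_space \<times> 'a \<Rightarrow> 'a) \<in> borel \<rightarrow>\<^sub>M borel"
  "(snd :: 'a::euclidean_space \<times> 'a \<Rightarrow> 'a) \<in> borel \<rightarrow>\<^sub>M borel"
  by (intro borel_measurable_continuous_onI continuous_intros)+

lemma finite_borel_measures_marginals:
  fixes \<gamma> :: "('a::euclidean_space \<times> 'a) measure"
  assumes "\<gamma> \<in> finite_borel_measures"
  shows "finite_measure (marginal0 \<gamma>)" "finite_measure (marginal1 \<gamma>)"
    "f \<in> borel_measurable borel \<Longrightarrow> integrable (marginal0 \<gamma>) f \<longleftrightarrow> integrable \<gamma> (\<lambda>z. (f (fst z) :: real))"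
    "f \<in> borel_measurable borel \<Longrightarrow> integrable (marginal1 \<gamma>) f \<longleftrightarrow> integrable \<gamma> (\<lambda>z. f (snd z))"
    "f \<in> borel_measurable borel \<Longrightarrow> (\<integral>x. f x \<partial>marginal0 \<gamma>) = (\<integral>z. f (fst z) \<partial>\<gamma>)"
    "f \<in> borel_measurable borel \<Longrightarrow> (\<integral>x. f x \<partial>marginal1 \<gamma>) = (\<integral>z. f (snd z) \<partial>\<gamma>)"
proof -
  have s [measurable_cong]: "sets \<gamma> = sets borel" and fin: "finite_measure \<gamma>"
    using assms by (auto simp: finite_borel_measures_def)
  note [measurable] = fst_snd_measurable_borel
  have m: "fst \<in> \<gamma> \<rightarrow>\<^sub>M borel" "snd \<in> \<gamma> \<rightarrow>\<^sub>M borel" by measurable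
  show "finite_measure (marginal0 \<gamma>)" "finite_measure (marginal1 \<gamma>)"
    using m by (simp_all add: marginal0_def marginal1_def finite_measure.finite_measure_distr[OF fin])
  show "f \<in> borel_measurable borel \<Longrightarrow> integrable (marginal0 \<gamma>) f \<longleftrightarrow> integrable \<gamma> (\<lambda>z. f (fst z))"
    "f \<in> borel_measurable borel \<Longrightarrow> integrable (marginal1 \<gamma>) f \<longleftrightarrow> integrable \<gamma> (\<lambda>z. f (snd z))"
    using m by (simp_all add: marginal0_def marginal1_def integrable_distr_eq)
  show "f \<in> borel_measurable borel \<Longrightarrow> (\<integral>x. f x \<partial>marginal0 \<gamma>) = (\<integral>z. f (fst z) \<partial>\<gamma>)"
    "f \<in> borel_measurable borel \<Longrightarrow> (\<integral>x. f x \<partial>marginal1 \<gamma>) = (\<integral>z. f (snd z) \<partial>\<gamma>)"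
    using m by (simp_all add: marginal0_def marginal1_def integral_distr)
qed

lemma quad_cost_alt: "quad_cost \<gamma> = (\<integral>\<^sup>+z. ennreal ((norm (fst z - snd z))\<^sup>2) \<partial>\<gamma>)"
  unfolding quad_cost_def by (intro nn_integral_cong) (simp add: case_prod_beta)

lemma quad_cost_measurable:
  "(\<lambda>z. (norm (fst z - snd z))\<^sup>2) \<in> borel_measurable (borel :: ('a::euclidean_space \<times> 'a) measure)"
  by (intro borel_measurable_continuous_onI continuous_intros)

lemma quad_cost_finite:
  fixes \<gamma> :: "('a::euclidean_space \<times> 'a) measure"
  assumes "\<gamma> \<in> finite_borel_measures"
  shows "quad_cost \<gamma> < \<infinity> \<longleftrightarrow> integrable \<gamma> (\<lambda>z. (norm (fst z - snd z))\<^sup>2)"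
    and "integrable \<gamma> (\<lambda>z. (norm (fst z - snd z))\<^sup>2) \<Longrightarrow> quad_cost \<gamma> = ennreal (\<integral>z. (norm (fst z - snd z))\<^sup>2 \<partial>\<gamma>)"
proof -
  have [measurable_cong]: "sets \<gamma> = sets borel"
    using assms by (auto simp: finite_borel_measures_def)
  note [measurable] = quad_cost_measurable
  show "quad_cost \<gamma> < \<infinity> \<longleftrightarrow> integrable \<gamma> (\<lambda>z. (norm (fst z - snd z))\<^sup>2)"
    by (auto simp: quad_cost_alt integrable_iff_bounded)
  show "integrable \<gamma> (\<lambda>z. (norm (fst z - snd z))\<^sup>2) \<Longrightarrow> quad_cost \<gamma> = ennreal (\<integral>z. (norm (fst z - snd z))\<^sup>2 \<partial>\<gamma>)"
    by (simp add: quad_cost_alt nn_integral_eq_integral)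
qed

text \<open>The transport half of the duality: the slack in the constraint is a nonnegative
  function, and its integral is zero precisely when it vanishes almost everywhere.\<close>

lemma quad_cost_ge_potentials:
  fixes \<gamma> :: "('a::euclidean_space \<times> 'a) measure"
  assumes \<gamma>: "\<gamma> \<in> finite_borel_measures"
    and int: "integrable \<gamma> (\<lambda>z. (norm (fst z - snd z))\<^sup>2)"
    and meas: "f \<in> borel_measurable borel" "g \<in> borel_measurable borel"
    and le: "\<And>x y. f x + g y \<le> (norm (x - y))\<^sup>2"
    and intf: "integrable (marginal0 \<gamma>) f" "integrable (marginal1 \<gamma>) g"
  shows "(\<integral>x. f x \<partial>marginal0 \<gamma>) + (\<integral>y. g y \<partial>marginal1 \<gamma>) \<le> (\<integral>z. (norm (fst z - snd z))\<^sup>2 \<partial>\<gamma>)"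
    and "(\<integral>x. f x \<partial>marginal0 \<gamma>) + (\<integral>y. g y \<partial>marginal1 \<gamma>) = (\<integral>z. (norm (fst z - snd z))\<^sup>2 \<partial>\<gamma>)
      \<longleftrightarrow> (AE z in \<gamma>. f (fst z) + g (snd z) = (norm (fst z - snd z))\<^sup>2)"
proof -
  note M = finite_borel_measures_marginals[OF \<gamma>]
  let ?c = "\<lambda>z::'a \<times> 'a. (norm (fst z - snd z))\<^sup>2"
  have i: "integrable \<gamma> (\<lambda>z. f (fst z))" "integrable \<gamma> (\<lambda>z. g (snd z))"
    using intf meas by (simp_all add: M)
  have eq: "(\<integral>z. ?c z \<partial>\<gamma>) - ((\<integral>x. f x \<partial>marginal0 \<gamma>) + (\<integral>y. g y \<partial>marginal1 \<gamma>))
      = (\<integral>z. ?c z - (f (fst z) + g (snd z)) \<partial>\<gamma>)"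
    using i int meas by (simp add: M)
  have nn: "0 \<le> ?c z - (f (fst z) + g (snd z))" for z using le[of "fst z" "snd z"] by simp
  have "0 \<le> (\<integral>z. ?c z - (f (fst z) + g (snd z)) \<partial>\<gamma>)"
    by (rule Bochner_Integration.integral_nonneg) (rule nn)
  then show "(\<integral>x. f x \<partial>marginal0 \<gamma>) + (\<integral>y. g y \<partial>marginal1 \<gamma>) \<le> (\<integral>z. ?c z \<partial>\<gamma>)"
    using eq by linarith
  have "(\<integral>z. ?c z - (f (fst z) + g (snd z)) \<partial>\<gamma>) = 0 \<longleftrightarrow> (AE z in \<gamma>. ?c z - (f (fst z) + g (snd z)) = 0)"
    using i int nn by (intro integral_nonneg_eq_0_iff_AE) auto
  also have "\<dots> \<longleftrightarrow> (AE z in \<gamma>. f (fst z) + g (snd z) = ?c z)"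
    by (intro AE_cong) auto
  finally show "(\<integral>x. f x \<partial>marginal0 \<gamma>) + (\<integral>y. g y \<partial>marginal1 \<gamma>) = (\<integral>z. ?c z \<partial>\<gamma>)
      \<longleftrightarrow> (AE z in \<gamma>. f (fst z) + g (snd z) = ?c z)"
    using eq by auto
qed

text \<open>The dual pair bounds every competing coupling from below and \<open>\<pi>\<close> meets
  the bound, so the infimum in \<open>W2\<close> is attained at \<open>\<pi>\<close>.\<close>

lemma W2_squared_eq_potentials:
  fixes \<pi> :: "('a::euclidean_space \<times> 'a) measure"
  assumes \<pi>: "\<pi> \<in> couplings p q"
    and int: "integrable \<pi> (\<lambda>z. (norm (fst z - snd z))\<^sup>2)"
    and meas: "f \<in> borel_measurable borel" "g \<in> borel_measurable borel"
    and le: "\<And>x y. f x + g y \<le> (norm (x - y))\<^sup>2"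
    and intf: "integrable p f" "integrable q g"
    and eq: "AE z in \<pi>. f (fst z) + g (snd z) = (norm (fst z - snd z))\<^sup>2"
  shows "(W2 p q)\<^sup>2 = (\<integral>z. (norm (fst z - snd z))\<^sup>2 \<partial>\<pi>)"
proof -
  let ?c = "\<lambda>z::'a \<times> 'a. (norm (fst z - snd z))\<^sup>2"
  have \<pi>': "\<pi> \<in> finite_borel_measures" "marginal0 \<pi> = p" "marginal1 \<pi> = q"
    using \<pi> by (auto simp: couplings_def)
  have cost: "quad_cost \<pi> = ennreal (\<integral>z. ?c z \<partial>\<pi>)" by (rule quad_cost_finite(2)[OF \<pi>'(1) int])
  have val: "(\<integral>x. f x \<partial>p) + (\<integral>y. g y \<partial>q) = (\<integral>z. ?c z \<partial>\<pi>)"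
    using quad_cost_ge_potentials(2)[OF \<pi>'(1) int meas le] intf eq unfolding \<pi>' by blast
  have "quad_cost \<pi> \<le> quad_cost \<gamma>" if "\<gamma> \<in> couplings p q" for \<gamma>
  proof (cases "quad_cost \<gamma> < \<infinity>")
    case True
    have \<gamma>: "\<gamma> \<in> finite_borel_measures" "marginal0 \<gamma> = p" "marginal1 \<gamma> = q"
      using that by (auto simp: couplings_def)
    have i: "integrable \<gamma> ?c" using True quad_cost_finite(1)[OF \<gamma>(1)] by simp
    have "(\<integral>z. ?c z \<partial>\<pi>) \<le> (\<integral>z. ?c z \<partial>\<gamma>)"
      using quad_cost_ge_potentials(1)[OF \<gamma>(1) i meas le] intf unfolding \<gamma> val by blast
    then show ?thesis unfolding cost quad_cost_finite(2)[OF \<gamma>(1) i] by (rule ennreal_leI)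
  qed (simp add: less_top[symmetric])
  then have "(INF \<gamma>\<in>couplings p q. quad_cost \<gamma>) = quad_cost \<pi>"
    using \<pi> by (intro antisym INF_lower INF_greatest) auto
  moreover have "(\<integral>z. ?c z \<partial>\<pi>) \<ge> 0" by (rule Bochner_Integration.integral_nonneg) simp
  ultimately show ?thesis by (simp add: W2_def cost)
qed

text \<open>Adds three inequalities: one from Young for each marginal, and the potential bound for
  the transport cost. In the equality case the first marginal is recorded because, together with the
  contact set, it will determine the plan.\<close>

lemma unbalanced_objective_lower_bound:
  fixes \<alpha> \<beta> :: "'a::euclidean_space measure"
  assumes \<alpha>: "finite_measure \<alpha>" "sets \<alpha> = sets borel" and \<beta>: "finite_measure \<beta>" "sets \<beta> = sets borel"
    and \<tau>: "\<tau>0 > 0" "\<tau>1 > 0"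
    and meas: "\<phi> \<in> borel_measurable borel" "\<psi> \<in> borel_measurable borel"
    and le: "\<And>x y. \<phi> x + \<psi> y \<le> (norm (x - y))\<^sup>2"
    and int: "integrable \<alpha> (\<lambda>x. exp (- \<phi> x / \<tau>0))" "integrable \<beta> (\<lambda>y. exp (- \<psi> y / \<tau>1))"
    and \<gamma>: "\<gamma> \<in> finite_borel_measures" and fin: "unbalanced_objective \<tau>0 \<tau>1 \<alpha> \<beta> \<gamma> < \<infinity>"
  defines "D \<equiv> \<tau>0 * (measure \<alpha> (space \<alpha>) - (\<integral>x. exp (- \<phi> x / \<tau>0) \<partial>\<alpha>))
    + \<tau>1 * (measure \<beta> (space \<beta>) - (\<integral>y. exp (- \<psi> y / \<tau>1) \<partial>\<beta>))"
  shows "ennreal D \<le> unbalanced_objective \<tau>0 \<tau>1 \<alpha> \<beta> \<gamma>"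
    and "D \<ge> 0 \<Longrightarrow> unbalanced_objective \<tau>0 \<tau>1 \<alpha> \<beta> \<gamma> = ennreal D \<Longrightarrow>
      marginal0 \<gamma> = density \<alpha> (\<lambda>x. ennreal (exp (- \<phi> x / \<tau>0)))
      \<and> (AE z in \<gamma>. \<phi> (fst z) + \<psi> (snd z) = (norm (fst z - snd z))\<^sup>2)"
proof -
  note M = finite_borel_measures_marginals[OF \<gamma>]
  have s [measurable_cong]: "sets \<gamma> = sets borel"
    using \<gamma> by (auto simp: finite_borel_measures_def)
  note [measurable] = meas fst_snd_measurable_borel
  let ?c = "\<lambda>z::'a \<times> 'a. (norm (fst z - snd z))\<^sup>2"
  have q: "quad_cost \<gamma> < \<infinity>" and k0: "gen_KL (marginal0 \<gamma>) \<alpha> < \<infinity>" and k1: "gen_KL (marginal1 \<gamma>) \<beta> < \<infinity>"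
    using fin \<tau> by (auto simp: unbalanced_objective_def less_top[symmetric] ennreal_mult_eq_top_iff)
  have intc: "integrable \<gamma> ?c" using q quad_cost_finite(1)[OF \<gamma>] by simp
  have sets: "sets (marginal0 \<gamma>) = sets \<alpha>" "sets (marginal1 \<gamma>) = sets \<beta>"
    by (simp_all add: marginal0_def marginal1_def \<alpha> \<beta>)
  have m: "\<phi> \<in> borel_measurable \<alpha>" "\<psi> \<in> borel_measurable \<beta>"
    using meas by (simp_all add: measurable_cong_sets[OF \<alpha>(2) refl] measurable_cong_sets[OF \<beta>(2) refl])
  note g0 = gen_KL_gap[OF \<alpha>(1) M(1) sets(1) \<tau>(1) m(1) int(1) k0]
  note g1 = gen_KL_gap[OF \<beta>(1) M(2) sets(2) \<tau>(2) m(2) int(2) k1]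
  have neg: "integrable \<gamma> (\<lambda>z. max 0 (- \<phi> (fst z)))" "integrable \<gamma> (\<lambda>z. max 0 (- \<psi> (snd z)))"
    using g0(1) g1(1) by (simp_all add: M)
  \<comment> \<open>The constraint gives
    \<open>\<phi> x \<le> (norm (x - y))\<^sup>2 + max 0 (- \<psi> y)\<close>, and the right-hand
    side is integrable against the plan even though its marginals have no known moments.\<close>
  have int\<phi>: "integrable (marginal0 \<gamma>) \<phi>"
    unfolding M(3)[OF meas(1)]
  proof (rule Bochner_Integration.integrable_bound)
    show "integrable \<gamma> (\<lambda>z. ?c z + max 0 (- \<psi> (snd z)) + max 0 (- \<phi> (fst z)))"
      using intc neg by auto
    have "\<bar>\<phi> x\<bar> \<le> (norm (x - y))\<^sup>2 + max 0 (- \<psi> y) + max 0 (- \<phi> x)" for x y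
      using le[of x y] zero_le_power2[of "norm (x - y)"] by linarith
    then show "AE z in \<gamma>. norm (\<phi> (fst z)) \<le> norm (?c z + max 0 (- \<psi> (snd z)) + max 0 (- \<phi> (fst z)))"
      by (intro AE_I2) (simp add: order_trans[OF _ abs_ge_self])
  qed measurable
  have int\<psi>: "integrable (marginal1 \<gamma>) \<psi>"
    unfolding M(4)[OF meas(2)]
  proof (rule Bochner_Integration.integrable_bound)
    show "integrable \<gamma> (\<lambda>z. ?c z + max 0 (- \<phi> (fst z)) + max 0 (- \<psi> (snd z)))"
      using intc neg by auto
    have "\<bar>\<psi> y\<bar> \<le> (norm (x - y))\<^sup>2 + max 0 (- \<phi> x) + max 0 (- \<psi> y)" for x y
      using le[of x y] zero_le_power2[of "norm (x - y)"] by linarith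
    then show "AE z in \<gamma>. norm (\<psi> (snd z)) \<le> norm (?c z + max 0 (- \<phi> (fst z)) + max 0 (- \<psi> (snd z)))"
      by (intro AE_I2) (simp add: order_trans[OF _ abs_ge_self])
  qed measurable
  note c = quad_cost_ge_potentials[OF \<gamma> intc meas le int\<phi> int\<psi>]
  let ?x = "(\<integral>z. ?c z \<partial>\<gamma>) + \<tau>0 * enn2real (gen_KL (marginal0 \<gamma>) \<alpha>) + \<tau>1 * enn2real (gen_KL (marginal1 \<gamma>) \<beta>)"
  have c0: "(\<integral>z. ?c z \<partial>\<gamma>) \<ge> 0" by (rule Bochner_Integration.integral_nonneg) simp
  have "ennreal \<tau> * k = ennreal (\<tau> * enn2real k)" if "k < \<infinity>" "\<tau> > 0" for \<tau> k
    using that by (simp add: ennreal_mult'' less_top)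
  then have obj: "unbalanced_objective \<tau>0 \<tau>1 \<alpha> \<beta> \<gamma> = ennreal ?x"
    unfolding unbalanced_objective_def quad_cost_finite(2)[OF \<gamma> intc]
    using k0 k1 \<tau> c0 by (simp add: ennreal_plus)
  have "D \<le> ?x" unfolding D_def using g0(2)[OF int\<phi>] g1(2)[OF int\<psi>] c(1) by linarith
  then show "ennreal D \<le> unbalanced_objective \<tau>0 \<tau>1 \<alpha> \<beta> \<gamma>" unfolding obj by (rule ennreal_leI)
  \<comment> \<open>\<open>ennreal\<close> sends every negative real to zero, so the sign of
    \<open>D\<close> is what allows passing from equal extended values to equal reals.\<close>
  assume D0: "D \<ge> 0" and eq: "unbalanced_objective \<tau>0 \<tau>1 \<alpha> \<beta> \<gamma> = ennreal D"
  have "?x \<ge> 0" using c0 \<tau> by (simp add: add_nonneg_nonneg)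
  then have "?x = D" using eq D0 unfolding obj by (simp only: ennreal_inj)
  \<comment> \<open>The three inequalities add up to an equality, hence each of them is
    tight.\<close>
  then show "marginal0 \<gamma> = density \<alpha> (\<lambda>x. ennreal (exp (- \<phi> x / \<tau>0)))
      \<and> (AE z in \<gamma>. \<phi> (fst z) + \<psi> (snd z) = ?c z)"
    unfolding D_def using g0(2,3)[OF int\<phi>] g1(2)[OF int\<psi>] c by linarith
qed

text \<open>Complementary slackness makes all three inequalities behind the lower bound equalities.
  The sign of \<open>D\<close> is recorded for the equality case there.\<close>

lemma unbalanced_objective_attained:
  fixes \<alpha> \<beta> :: "'a::euclidean_space measure"
  assumes \<alpha>: "finite_measure \<alpha>" "sets \<alpha> = sets borel" and \<beta>: "finite_measure \<beta>" "sets \<beta> = sets borel"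
    and \<tau>: "\<tau>0 > 0" "\<tau>1 > 0"
    and meas: "\<phi> \<in> borel_measurable borel" "\<psi> \<in> borel_measurable borel"
    and le: "\<And>x y. \<phi> x + \<psi> y \<le> (norm (x - y))\<^sup>2"
    and \<gamma>: "\<gamma> \<in> finite_borel_measures"
    and marg: "marginal0 \<gamma> = density \<alpha> (\<lambda>x. ennreal (exp (- \<phi> x / \<tau>0)))"
      "marginal1 \<gamma> = density \<beta> (\<lambda>y. ennreal (exp (- \<psi> y / \<tau>1)))"
    and int: "integrable (marginal0 \<gamma>) \<phi>" "integrable (marginal1 \<gamma>) \<psi>"
      "integrable \<gamma> (\<lambda>z. (norm (fst z - snd z))\<^sup>2)"
    and ae: "AE z in \<gamma>. \<phi> (fst z) + \<psi> (snd z) = (norm (fst z - snd z))\<^sup>2"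
  defines "D \<equiv> \<tau>0 * (measure \<alpha> (space \<alpha>) - (\<integral>x. exp (- \<phi> x / \<tau>0) \<partial>\<alpha>))
    + \<tau>1 * (measure \<beta> (space \<beta>) - (\<integral>y. exp (- \<psi> y / \<tau>1) \<partial>\<beta>))"
  shows "unbalanced_objective \<tau>0 \<tau>1 \<alpha> \<beta> \<gamma> = ennreal D" "D \<ge> 0"
proof -
  note M = finite_borel_measures_marginals[OF \<gamma>]
  have m: "\<phi> \<in> borel_measurable \<alpha>" "\<psi> \<in> borel_measurable \<beta>"
    using meas by (simp_all add: measurable_cong_sets[OF \<alpha>(2) refl] measurable_cong_sets[OF \<beta>(2) refl])
  note a0 = gen_KL_gap_attained[OF \<alpha>(1) \<tau>(1) m(1) marg(1) M(1) int(1)]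
  note a1 = gen_KL_gap_attained[OF \<beta>(1) \<tau>(2) m(2) marg(2) M(2) int(2)]
  let ?c = "\<lambda>z::'a \<times> 'a. (norm (fst z - snd z))\<^sup>2"
  let ?x = "(\<integral>z. ?c z \<partial>\<gamma>) + \<tau>0 * enn2real (gen_KL (marginal0 \<gamma>) \<alpha>) + \<tau>1 * enn2real (gen_KL (marginal1 \<gamma>) \<beta>)"
  have c0: "(\<integral>z. ?c z \<partial>\<gamma>) \<ge> 0" by (rule Bochner_Integration.integral_nonneg) simp
  have "ennreal \<tau> * k = ennreal (\<tau> * enn2real k)" if "k < \<infinity>" "\<tau> > 0" for \<tau> k
    using that by (simp add: ennreal_mult'' less_top)
  then have obj: "unbalanced_objective \<tau>0 \<tau>1 \<alpha> \<beta> \<gamma> = ennreal ?x"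
    unfolding unbalanced_objective_def quad_cost_finite(2)[OF \<gamma> int(3)]
    using a0(1) a1(1) \<tau> c0 by (simp add: ennreal_plus)
  have x0: "?x \<ge> 0" using c0 \<tau> by (simp add: add_nonneg_nonneg)
  have "(\<integral>x. \<phi> x \<partial>marginal0 \<gamma>) + (\<integral>y. \<psi> y \<partial>marginal1 \<gamma>) = (\<integral>z. ?c z \<partial>\<gamma>)"
    using quad_cost_ge_potentials(2)[OF \<gamma> int(3) meas le int(1,2)] ae by simp
  then have "?x = D" unfolding D_def using a0(2) a1(2) by linarith
  then show "unbalanced_objective \<tau>0 \<tau>1 \<alpha> \<beta> \<gamma> = ennreal D" "D \<ge> 0" using obj x0 by simp_all
qed

text \<open>Almost everywhere \<open>z = (fst z, T (fst z))\<close>, so the plan is the image of its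
  first marginal under the graph map.\<close>

lemma measure_on_graph_eq:
  fixes \<gamma> :: "('a::euclidean_space \<times> 'a) measure"
  assumes \<gamma>: "sets \<gamma> = sets borel" and T [measurable]: "T \<in> borel \<rightarrow>\<^sub>M borel"
    and ae: "AE z in \<gamma>. snd z = T (fst z)"
  shows "\<gamma> = distr (marginal0 \<gamma>) borel (\<lambda>x. (x, T x))"
proof -
  note [measurable_cong] = \<gamma>
  note [measurable] = fst_snd_measurable_borel
  have g [measurable]: "(\<lambda>x. (x, T x)) \<in> borel \<rightarrow>\<^sub>M borel"
    by (rule borel_measurable_Pair) auto
  have "distr (marginal0 \<gamma>) borel (\<lambda>x. (x, T x)) = distr \<gamma> borel (\<lambda>z. (fst z, T (fst z)))"
    unfolding marginal0_def by (subst distr_distr) (auto simp: comp_def)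
  also have "\<dots> = distr \<gamma> borel (\<lambda>z. z)"
    by (rule distr_cong_AE) (use ae in \<open>auto elim!: eventually_mono simp: prod_eq_iff\<close>)
  also have "\<dots> = \<gamma>" by (rule distr_id2) (simp add: \<gamma>)
  finally show ?thesis by simp
qed

subsection \<open>The Gaussian solution\<close>

text \<open>With \<open>D\<close> the root of \<open>C1\<close> and \<open>K = D ** C0 ** D\<close>,
  squaring the formula for \<open>S\<close> gives \<open>S ** S = \<kappa> *\<^sub>R S + K\<close>;
  conjugation by the inverse of \<open>D\<close> turns this into the equation for
  \<open>L\<close>.\<close>

lemma riccati_solution:
  fixes C0 C1 :: "real^'n^'n" and \<kappa> :: real
  assumes C0: "sym_posdef C0" and C1: "sym_posdef C1"
    and S: "S = (1/2) *\<^sub>R (\<kappa> *\<^sub>R mat 1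
                 + mat_sqrt (\<kappa>\<^sup>2 *\<^sub>R mat 1 + 4 *\<^sub>R (mat_sqrt C1 ** C0 ** mat_sqrt C1)))"
    and L: "L = matrix_inv (mat_sqrt C1) ** S ** matrix_inv (mat_sqrt C1)"
  shows "sym_posdef L" and "L *v (C1 *v (L *v x)) = C0 *v x + \<kappa> *\<^sub>R (L *v x)"
proof -
  define D where "D = mat_sqrt C1"
  define K where "K = D ** C0 ** D"
  define N where "N = \<kappa>\<^sup>2 *\<^sub>R mat 1 + 4 *\<^sub>R K"
  define R where "R = mat_sqrt N"
  have D: "sym_posdef D" "D ** D = C1" using mat_sqrt_posdef[OF C1] by (simp_all add: D_def)
  note invD = sym_posdef_invertible[OF D(1)]
  have K: "sym_posdef K" unfolding K_def by (rule sym_posdef_sandwich[OF C0 D(1)])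
  have Nv: "N *v x = \<kappa>\<^sup>2 *\<^sub>R x + 4 *\<^sub>R (K *v x)" for x
    by (simp add: N_def matrix_vector_mult_add_rdistrib flip: scaleR_matrix_vector_assoc)
  have N: "sym_posdef N"
    unfolding sym_posdef_def Nv inner_add_right
    using K by (auto simp: sym_posdef_def N_def transpose_add transpose_scalar add_nonneg_pos)
  have R: "sym_posdef R" "R ** R = N" using mat_sqrt_posdef[OF N] by (simp_all add: R_def)
  have S': "S = (1/2) *\<^sub>R (\<kappa> *\<^sub>R mat 1 + R)" by (simp add: S R_def N_def K_def D_def)
  have Sv: "S *v x = (1/2) *\<^sub>R (\<kappa> *\<^sub>R x + R *v x)" for x
    by (simp add: S' matrix_vector_mult_add_rdistrib flip: scaleR_matrix_vector_assoc)
  have RR: "R *v (R *v x) = \<kappa>\<^sup>2 *\<^sub>R x + 4 *\<^sub>R (K *v x)" for x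
    by (simp add: matrix_vector_mul_assoc R(2) Nv)
  have SS: "S *v (S *v x) = \<kappa> *\<^sub>R (S *v x) + K *v x" for x
    by (simp add: Sv matrix_vector_right_distrib matrix_vector_mult_scaleR RR scaleR_add_right
        power2_eq_square) (simp add: vec_eq_iff field_simps)
  have "sym_posdef S"
  proof (rule sym_posdefI_eigen)
    show "transpose S = S"
      using R(1) by (simp add: S' transpose_scalar transpose_add sym_posdef_def)
    fix e s assume e: "norm e = 1" "S *v e = s *\<^sub>R e"
    \<comment> \<open>An eigenvector of \<open>S\<close> for \<open>s\<close> is one of
      \<open>R\<close> for \<open>t\<close>. Positivity of \<open>K\<close> gives
      \<open>\<kappa>\<^sup>2 < t\<^sup>2\<close>, hence \<open>s = (\<kappa> + t) / 2 > 0\<close>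
      whatever the sign of \<open>\<kappa>\<close>.\<close>
    define t where "t = 2 * s - \<kappa>"
    have e0: "e \<noteq> 0" "e \<bullet> e = 1" using e by (auto simp: norm_eq_1)
    have "2 *\<^sub>R (S *v e) = \<kappa> *\<^sub>R e + R *v e" by (simp add: Sv)
    then have Re: "R *v e = t *\<^sub>R e" unfolding e(2) by (simp add: t_def algebra_simps)
    have "e \<bullet> (R *v e) > 0" using R(1) e0 by (auto simp: sym_posdef_def)
    then have t: "t > 0" using Re e0 by simp
    have "e \<bullet> (R *v (R *v e)) = t\<^sup>2" using Re e0 by (simp add: matrix_vector_mult_scaleR power2_eq_square)
    moreover have "e \<bullet> (K *v e) > 0" using K e0 by (auto simp: sym_posdef_def)
    ultimately have "\<kappa>\<^sup>2 < t\<^sup>2" using e0 by (simp add: RR inner_add_right)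
    then have "\<bar>\<kappa>\<bar> < t" using t by (metis abs_of_pos power2_abs power2_less_imp_less less_imp_le)
    then show "s > 0" by (simp add: t_def abs_less_iff)
  qed
  then show "sym_posdef L" unfolding L D_def[symmetric]
    by (rule sym_posdef_sandwich[OF _ sym_posdef_inv[OF D(1)]])
  have Lv: "L *v x = matrix_inv D *v (S *v (matrix_inv D *v x))" for x
    by (simp add: L D_def matrix_vector_mul_assoc matrix_mul_assoc)
  have Cv: "C1 *v x = D *v (D *v x)" for x by (simp add: matrix_vector_mul_assoc D(2))
  have Kv: "K *v x = D *v (C0 *v (D *v x))" for x by (simp add: matrix_vector_mul_assoc matrix_mul_assoc K_def)
  show "L *v (C1 *v (L *v x)) = C0 *v x + \<kappa> *\<^sub>R (L *v x)"
    by (simp add: Lv Cv Kv SS matrix_inv_vector[OF invD] matrix_vector_right_distrib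
        matrix_vector_mult_scaleR)
qed

text \<open>If \<open>f \<bullet> X f \<le> 0\<close>, the two representations of \<open>X\<close> give \<open>f \<bullet> f < f \<bullet> L f\<close> and
  \<open>L f \<bullet> L f < f \<bullet> L f\<close>, contradicting the Cauchy-Schwarz inequality.\<close>

lemma precision_posdef:
  fixes A0 A1 L :: "real^'n^'n" and r0 r1 :: real
  assumes A0: "sym_posdef A0" and A1: "sym_posdef A1" and L: "sym_posdef L" and r: "r0 > 0" "r1 > 0"
    and X: "X = A0 + r0 *\<^sub>R (mat 1 - L)"
    and eq: "\<And>x. X *v x = L *v (A1 *v (L *v x)) + r1 *\<^sub>R (L *v (L *v x)) - r1 *\<^sub>R (L *v x)"
  shows "sym_posdef X"
  unfolding sym_posdef_def
proof (intro conjI allI impI)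
  have symL: "transpose L = L" using L by (simp add: sym_posdef_def)
  show "transpose X = X"
    using A0 symL by (simp add: X transpose_add transpose_scalar transpose_diff sym_posdef_def)
  fix f :: "real^'n" assume f: "f \<noteq> 0"
  let ?g = "L *v f"
  have fg: "f \<bullet> ?g > 0" using L f by (auto simp: sym_posdef_def)
  then have g: "?g \<noteq> 0" by auto
  show "0 < f \<bullet> (X *v f)"
  proof (rule ccontr)
    assume neg: "\<not> 0 < f \<bullet> (X *v f)"
    have "f \<bullet> (X *v f) = f \<bullet> (A0 *v f) + r0 * (f \<bullet> f - f \<bullet> ?g)"
      by (simp add: X matrix_vector_mult_add_rdistrib matrix_vector_mult_diff_rdistrib inner_add_right
          inner_diff_right flip: scaleR_matrix_vector_assoc)
    moreover have "f \<bullet> (A0 *v f) > 0" using A0 f by (auto simp: sym_posdef_def)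
    ultimately have "r0 * (f \<bullet> f - f \<bullet> ?g) < 0" using neg by linarith
    then have ff: "f \<bullet> f < f \<bullet> ?g" using r by (simp add: mult_less_0_iff)
    have "f \<bullet> (X *v f) = ?g \<bullet> (A1 *v ?g) + r1 * (?g \<bullet> ?g - f \<bullet> ?g)"
      unfolding eq by (simp add: inner_add_right inner_diff_right symmetric_inner[OF symL] algebra_simps)
    moreover have "?g \<bullet> (A1 *v ?g) > 0" using A1 g by (auto simp: sym_posdef_def)
    ultimately have "r1 * (?g \<bullet> ?g - f \<bullet> ?g) < 0" using neg by linarith
    then have gg: "?g \<bullet> ?g < f \<bullet> ?g" using r by (simp add: mult_less_0_iff)
    have "(f \<bullet> f) * (?g \<bullet> ?g) < (f \<bullet> ?g) * (f \<bullet> ?g)"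
      using ff gg fg by (intro mult_strict_mono) auto
    then show False using Cauchy_Schwarz_ineq[of f ?g] by (simp add: power2_eq_square)
  qed
qed

text \<open>Both functions are dominated by a multiple of \<open>1 + (norm x)\<^sup>2\<close>. These
  are the building blocks of the potentials.\<close>

lemma gaussian_integrable_quadratic:
  fixes \<Sigma> B :: "real^'n^'n"
  assumes \<Sigma>: "sym_posdef \<Sigma>"
  shows "integrable (gaussian m \<Sigma>) (\<lambda>x. (x - u) \<bullet> (B *v (x - u)))"
    and "integrable (gaussian m \<Sigma>) (\<lambda>x. b \<bullet> (x - u))"
proof -
  interpret prob_space "gaussian m \<Sigma>" by (rule prob_space_gaussian[OF \<Sigma>])
  note fin = finite_measure_axioms and sm = gaussian_second_moment[OF \<Sigma>, of m]
  have sq: "(norm (x - u))\<^sup>2 \<le> 2 * (norm x)\<^sup>2 + 2 * (norm u)\<^sup>2" for x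
    using norm_add_squared_le[of x "- u"] by simp
  obtain K where K: "\<And>x. norm (B *v x) \<le> norm x * K" and K0: "K > 0"
    using bounded_linear.pos_bounded[OF matrix_vector_mul_bounded_linear[of B]] by blast
  have "\<bar>(x - u) \<bullet> (B *v (x - u))\<bar> \<le> (2 * K * (1 + (norm u)\<^sup>2)) * (1 + (norm x)\<^sup>2)" for x
  proof -
    have "\<bar>(x - u) \<bullet> (B *v (x - u))\<bar> \<le> norm (x - u) * (norm (x - u) * K)"
      using Cauchy_Schwarz_ineq2 K by (meson mult_left_mono norm_ge_zero order_trans)
    also have "\<dots> = K * (norm (x - u))\<^sup>2" by (simp add: power2_eq_square)
    also have "\<dots> \<le> K * (2 * (norm x)\<^sup>2 + 2 * (norm u)\<^sup>2)"
      using sq K0 by simp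
    also have "\<dots> \<le> K * (2 * (1 + (norm u)\<^sup>2) * (1 + (norm x)\<^sup>2))"
      using K0 by (intro mult_left_mono) (auto simp: algebra_simps)
    finally show ?thesis by (simp add: mult_ac)
  qed
  then show "integrable (gaussian m \<Sigma>) (\<lambda>x. (x - u) \<bullet> (B *v (x - u)))"
    by (intro integrable_quadratic_growth[OF fin sm]) auto
  have "\<bar>b \<bullet> (x - u)\<bar> \<le> ((norm b)\<^sup>2 + 2 * (1 + (norm u)\<^sup>2)) * (1 + (norm x)\<^sup>2)" for x
  proof -
    have "\<bar>b \<bullet> (x - u)\<bar> \<le> norm b * norm (x - u)" by (rule Cauchy_Schwarz_ineq2)
    also have "\<dots> \<le> (norm b)\<^sup>2 + (norm (x - u))\<^sup>2"
      using sum_squares_bound[of "norm b" "norm (x - u)"] zero_le_power2[of "norm b"]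
        zero_le_power2[of "norm (x - u)"] by linarith
    also have "\<dots> \<le> (norm b)\<^sup>2 + (2 * (norm x)\<^sup>2 + 2 * (norm u)\<^sup>2)" using sq by simp
    also have "\<dots> \<le> ((norm b)\<^sup>2 + 2 * (1 + (norm u)\<^sup>2)) * (1 + (norm x)\<^sup>2)"
      by (simp add: algebra_simps)
    finally show ?thesis .
  qed
  then show "integrable (gaussian m \<Sigma>) (\<lambda>x. b \<bullet> (x - u))"
    by (intro integrable_quadratic_growth[OF fin sm]) auto
qed

lemma scale_measure_eq_density: "scale_measure c M = density M (\<lambda>_. c)"
  by (rule measure_eqI) (simp_all add: emeasure_density_const)

text \<open>The two brackets are, up to constants, \<open>- \<tau>\<^sub>0\<close> and \<open>- \<tau>\<^sub>1\<close> times the log-densities of \<open>p\<close> and \<open>q\<close>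
  with respect to the reference Gaussians.\<close>

lemma quadratic_potentials_gap:
  fixes L :: "real^'n^'n" and u v h x y :: "real^'n"
  assumes L: "sym_posdef L" and h: "h = u - v"
  shows "(norm (x - y))\<^sup>2
      - ((x - u) \<bullet> (x - u) - (x - u) \<bullet> (L *v (x - u)) + 2 * (h \<bullet> (x - u)))
      - ((y - v) \<bullet> (y - v) - (y - v) \<bullet> (matrix_inv L *v (y - v)) - 2 * (h \<bullet> (y - v)) + h \<bullet> h)
    = (y - v - L *v (x - u)) \<bullet> (matrix_inv L *v (y - v - L *v (x - u)))"
proof -
  define x' y' where "x' = x - u" and "y' = y - v"
  note inv = sym_posdef_invertible[OF L]
  have "x - y = x' - y' + h" by (simp add: x'_def y'_def h)
  then have n: "(norm (x - y))\<^sup>2 = x' \<bullet> x' + y' \<bullet> y' + h \<bullet> h - 2 * (x' \<bullet> y') + 2 * (h \<bullet> x') - 2 * (h \<bullet> y')"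
    by (simp add: power2_norm_eq_inner inner_add_left inner_add_right inner_diff_left inner_diff_right inner_commute)
  have "transpose (matrix_inv L) = matrix_inv L" using sym_posdef_inv[OF L] by (simp add: sym_posdef_def)
  \<comment> \<open>Both mixed terms of the square on the right thereby equal
    \<open>x' \<bullet> y'\<close>, matching the mixed term of the cost.\<close>
  from symmetric_inner[OF this, of "L *v x'" y']
  have "(L *v x') \<bullet> (matrix_inv L *v y') = x' \<bullet> y'" by (simp add: matrix_inv_vector[OF inv])
  then show ?thesis
    unfolding n x'_def[symmetric] y'_def[symmetric]
    by (simp add: matrix_vector_mult_diff_distrib matrix_inv_vector[OF inv] inner_diff_left inner_diff_right
        inner_commute)
qed

theorem proposition3p2:
  fixes m0 m1 h u v :: "real^'n"
    and \<Sigma>0 \<Sigma>1 A0 A1 C0 C1 S L P Q :: "real^'n^'n"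
    and a b \<tau>0 \<tau>1 r0 r1 \<kappa> A M :: real
    and \<mu>0 \<mu>1 \<alpha> \<beta> p q :: "(real^'n) measure"
    and \<pi> \<gamma> :: "((real^'n) \<times> (real^'n)) measure"
  assumes posdef: "sym_posdef \<Sigma>0" "sym_posdef \<Sigma>1"
    and pos: "a > 0" "b > 0" "\<tau>0 > 0" "\<tau>1 > 0"
    and mu: "\<mu>0 = gaussian m0 \<Sigma>0" "\<mu>1 = gaussian m1 \<Sigma>1"
    and alpha: "\<alpha> = scale_measure (ennreal a) \<mu>0"
    and beta: "\<beta> = scale_measure (ennreal b) \<mu>1"
    and r: "r0 = 2 / \<tau>0" "r1 = 2 / \<tau>1"
    and A01: "A0 = matrix_inv \<Sigma>0" "A1 = matrix_inv \<Sigma>1"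
    and C01: "C0 = A0 + r0 *\<^sub>R mat 1" "C1 = A1 + r1 *\<^sub>R mat 1"
    and kappa: "\<kappa> = r1 - r0"
    and S: "S = (1/2) *\<^sub>R (\<kappa> *\<^sub>R mat 1
                 + mat_sqrt (\<kappa>\<^sup>2 *\<^sub>R mat 1 + 4 *\<^sub>R (mat_sqrt C1 ** C0 ** mat_sqrt C1)))"
    and L: "L = matrix_inv (mat_sqrt C1) ** S ** matrix_inv (mat_sqrt C1)"
    and P: "P = matrix_inv (A0 + r0 *\<^sub>R (mat 1 - L))"
    and Q: "Q = L ** P ** L"
    and h: "h = matrix_inv (mat 1 + r0 *\<^sub>R \<Sigma>0 + r1 *\<^sub>R \<Sigma>1) *v (m0 - m1)"
    and u: "u = m0 - r0 *\<^sub>R (\<Sigma>0 *v h)"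
    and v: "v = m1 + r1 *\<^sub>R (\<Sigma>1 *v h)"
    and p: "p = gaussian u P"
    and q: "q = gaussian v Q"
    and A: "A = (W2 p q)\<^sup>2 + \<tau>0 * enn2real (gen_KL p \<mu>0) + \<tau>1 * enn2real (gen_KL q \<mu>1)"
    and M: "M = a powr (\<tau>0 / (\<tau>0 + \<tau>1)) * b powr (\<tau>1 / (\<tau>0 + \<tau>1)) * exp (- A / (\<tau>0 + \<tau>1))"
    and coupling: "\<pi> = distr p borel (\<lambda>x. (x, v + L *v (x - u)))"
    and gamma: "\<gamma> = scale_measure (ennreal M) \<pi>"
  shows "KL_complementary_slackness \<tau>0 \<tau>1 \<alpha> \<beta> \<gamma> \<and>
         (\<exists>!\<gamma>'. is_arg_min (unbalanced_objective \<tau>0 \<tau>1 \<alpha> \<beta>) (\<lambda>\<eta>. \<eta> \<in> finite_borel_measures) \<gamma>')"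
proof -

  \<comment> \<open>Positive definiteness and the precision matrices of \<open>p\<close> and
    \<open>q\<close>\<close>
  have r0: "r0 > 0" "r1 > 0" using pos r by simp_all
  have A0: "sym_posdef A0" and A1: "sym_posdef A1"
    using posdef by (simp_all add: A01 sym_posdef_inv)
  note inv\<Sigma> = sym_posdef_invertible[OF posdef(1)] sym_posdef_invertible[OF posdef(2)]
  have C: "sym_posdef C0" "sym_posdef C1"
    unfolding C01 using r0 A0 A1
    by (simp_all add: sym_posdef_add sym_posdef_scaleR sym_posdef_mat_1)
  note Lpd = riccati_solution(1)[OF C S L] and riccati = riccati_solution(2)[OF C S L]
  note invL = sym_posdef_invertible[OF Lpd]
  have symL: "transpose L = L" using Lpd by (simp add: sym_posdef_def)
  define X where "X = A0 + r0 *\<^sub>R (mat 1 - L)"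
  have Xv: "X *v x = A0 *v x + r0 *\<^sub>R (x - L *v x)" for x
    by (simp add: X_def matrix_vector_mult_add_rdistrib matrix_vector_mult_diff_rdistrib
        flip: scaleR_matrix_vector_assoc)
  have C0v: "C0 *v x = A0 *v x + r0 *\<^sub>R x" and C1v: "C1 *v x = A1 *v x + r1 *\<^sub>R x" for x
    by (simp_all add: C01 matrix_vector_mult_add_rdistrib flip: scaleR_matrix_vector_assoc)
  \<comment> \<open>The Riccati equation, rewritten as a second representation of the precision
    \<open>X\<close> through \<open>A1\<close>. It yields positivity now and the inverse of
    \<open>Q\<close> below.\<close>
  have Xv': "X *v x = L *v (A1 *v (L *v x)) + r1 *\<^sub>R (L *v (L *v x)) - r1 *\<^sub>R (L *v x)" for x
    using riccati[of x] unfolding C0v C1v Xv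
    by (simp add: matrix_vector_right_distrib matrix_vector_mult_scaleR kappa algebra_simps)
  have X: "sym_posdef X" by (rule precision_posdef[OF A0 A1 Lpd r0 X_def Xv'])
  note invX = sym_posdef_invertible[OF X]
  have PX: "P = matrix_inv X" by (simp add: P X_def)
  have Ppd: "sym_posdef P" unfolding PX by (rule sym_posdef_inv[OF X])
  have Qpd: "sym_posdef Q" unfolding Q by (rule sym_posdef_sandwich[OF Ppd Lpd])
  have Pi: "matrix_inv P = X" by (rule matrix_inv_eqI) (simp add: PX matrix_mul_inv[OF invX])
  \<comment> \<open>Conjugating \<open>X\<close> by the inverse of \<open>L\<close> gives the mirror
    image of its definition: index 1 in place of 0, and the inverse of \<open>L\<close> in place of
    \<open>L\<close>.\<close>
  have Qi: "matrix_inv Q *v y = A1 *v y + r1 *\<^sub>R (y - matrix_inv L *v y)" for y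
  proof -
    have "Q *v (A1 *v y + r1 *\<^sub>R (y - matrix_inv L *v y)) = L *v (P *v (X *v (matrix_inv L *v y)))"
      unfolding Xv'
      by (simp add: Q matrix_inv_vector[OF invL] matrix_vector_right_distrib matrix_vector_mult_diff_distrib
          matrix_vector_mult_scaleR scaleR_diff_right flip: matrix_vector_mul_assoc)
    also have "\<dots> = y" by (simp add: PX matrix_inv_vector[OF invX] matrix_inv_vector[OF invL])
    finally show ?thesis by (metis matrix_inv_vector(2)[OF sym_posdef_invertible[OF Qpd]])
  qed
  \<comment> \<open>The linear system defining \<open>h\<close> says exactly that \<open>h\<close>
    is the difference of the two means it produces.\<close>
  have huv: "h = u - v"
  proof -
    let ?H = "mat 1 + r0 *\<^sub>R \<Sigma>0 + r1 *\<^sub>R \<Sigma>1"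
    have "sym_posdef ?H"
      using posdef r0 by (simp add: sym_posdef_add sym_posdef_scaleR sym_posdef_mat_1)
    then have "?H *v h = m0 - m1"
      unfolding h by (rule matrix_inv_vector(1)[OF sym_posdef_invertible])
    then have "h + r0 *\<^sub>R (\<Sigma>0 *v h) + r1 *\<^sub>R (\<Sigma>1 *v h) = m0 - m1"
      by (simp add: matrix_vector_mult_add_rdistrib flip: scaleR_matrix_vector_assoc)
    then show ?thesis unfolding u v by (simp add: algebra_simps)
  qed

  \<comment> \<open>Potentials for the balanced problem and the log-densities of \<open>p\<close>
    and \<open>q\<close>\<close>
  define F where "F x = (x - u) \<bullet> (x - u) - (x - u) \<bullet> (L *v (x - u)) + 2 * (h \<bullet> (x - u))" for x
  \<comment> \<open>The constant \<open>h \<bullet> h\<close> left by completing the square is put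
    entirely into \<open>G\<close>; hence the asymmetry between \<open>c0\<close> and
    \<open>c1\<close> below.\<close>
  define G where "G y = (y - v) \<bullet> (y - v) - (y - v) \<bullet> (matrix_inv L *v (y - v)) - 2 * (h \<bullet> (y - v)) + h \<bullet> h" for y
  define T where "T x = v + L *v (x - u)" for x
  have [measurable]: "F \<in> borel_measurable borel" "G \<in> borel_measurable borel" "T \<in> borel \<rightarrow>\<^sub>M borel"
    unfolding F_def G_def T_def by measurable
  note gap = quadratic_potentials_gap[OF Lpd huv, folded F_def G_def]
  have Lipd: "sym_posdef (matrix_inv L)" by (rule sym_posdef_inv[OF Lpd])
  have FG_le: "F x + G y \<le> (norm (x - y))\<^sup>2" for x y
    using gap[of x y] sym_posdef_imp_possemidef[OF Lipd] unfolding sym_possemidef_def by (smt (verit))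
  have FG_eq: "F x + G y = (norm (x - y))\<^sup>2 \<longleftrightarrow> y = T x" for x y
  proof -
    have "(y - v - L *v (x - u)) \<bullet> (matrix_inv L *v (y - v - L *v (x - u))) = 0 \<longleftrightarrow> y - v - L *v (x - u) = 0"
      using Lipd unfolding sym_posdef_def by (metis inner_zero_left less_irrefl)
    then show ?thesis using gap[of x y] by (auto simp: T_def algebra_simps)
  qed
  \<comment> \<open>\<open>c0\<close> is the log-density of \<open>p\<close> at \<open>u\<close>,
    where \<open>F\<close> vanishes: the squared displacement of \<open>u\<close> from
    \<open>m0\<close>, measured by \<open>A0\<close>, plus the determinant ratio. In
    \<open>c1\<close> the term \<open>r1 * (h \<bullet> h) / 2\<close> offsets the constant inside
    \<open>G\<close>.\<close>
  define c0 where "c0 = r0\<^sup>2 * (h \<bullet> (\<Sigma>0 *v h)) / 2 + ln (det \<Sigma>0 / det P) / 2"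
  define c1 where "c1 = r1 * (h \<bullet> h) / 2 + r1\<^sup>2 * (h \<bullet> (\<Sigma>1 *v h)) / 2 + ln (det \<Sigma>1 / det Q) / 2"
  have p_dens: "p = density \<mu>0 (\<lambda>x. ennreal (exp (- (F x - \<tau>0 * c0) / \<tau>0)))"
  proof -
    have "((x - m0) \<bullet> (matrix_inv \<Sigma>0 *v (x - m0)) - (x - u) \<bullet> (matrix_inv P *v (x - u))) / 2
        + ln (det \<Sigma>0 / det P) / 2 = - (F x - \<tau>0 * c0) / \<tau>0" for x
    proof -
      define x' where "x' = x - u"
      have xm: "x - m0 = x' - r0 *\<^sub>R (\<Sigma>0 *v h)" by (simp add: x'_def u)
      have sym: "(\<Sigma>0 *v h) \<bullet> (A0 *v x') = h \<bullet> x'"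
        using symmetric_inner[of A0 "\<Sigma>0 *v h" x'] A0
        by (simp add: sym_posdef_def A01 matrix_inv_vector[OF inv\<Sigma>(1)])
      have Ax: "(x - m0) \<bullet> (A0 *v (x - m0)) = x' \<bullet> (A0 *v x') - 2 * r0 * (h \<bullet> x') + r0\<^sup>2 * (h \<bullet> (\<Sigma>0 *v h))"
        unfolding xm using sym
        by (simp add: matrix_vector_mult_diff_distrib matrix_vector_mult_scaleR A01 matrix_inv_vector[OF inv\<Sigma>(1)]
            inner_diff_left inner_diff_right inner_commute power2_eq_square algebra_simps)
      have Xx: "x' \<bullet> (X *v x') = x' \<bullet> (A0 *v x') + r0 * (x' \<bullet> x' - x' \<bullet> (L *v x'))"
        by (simp add: Xv inner_add_right inner_diff_right)
      have "((x - m0) \<bullet> (A0 *v (x - m0)) - x' \<bullet> (X *v x')) / 2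
        = - (r0 * F x) / 2 + r0\<^sup>2 * (h \<bullet> (\<Sigma>0 *v h)) / 2"
      proof -
        have "r0 * F x = r0 * (x' \<bullet> x' - x' \<bullet> (L *v x')) + 2 * r0 * (h \<bullet> x')"
          by (simp add: F_def x'_def[symmetric] algebra_simps)
        then show ?thesis unfolding Ax Xx by (simp add: field_simps)
      qed
      then show ?thesis
        unfolding Pi A01(1)[symmetric] x'_def using pos by (simp add: c0_def r field_simps)
    qed
    then show ?thesis unfolding p mu gaussian_density_ratio[OF Ppd posdef(1), of u m0] by simp
  qed
  have q_dens: "q = density \<mu>1 (\<lambda>y. ennreal (exp (- (G y - \<tau>1 * c1) / \<tau>1)))"
  proof -
    have "((y - m1) \<bullet> (matrix_inv \<Sigma>1 *v (y - m1)) - (y - v) \<bullet> (matrix_inv Q *v (y - v))) / 2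
        + ln (det \<Sigma>1 / det Q) / 2 = - (G y - \<tau>1 * c1) / \<tau>1" for y
    proof -
      define y' where "y' = y - v"
      have ym: "y - m1 = y' + r1 *\<^sub>R (\<Sigma>1 *v h)" by (simp add: y'_def v)
      have sym: "(\<Sigma>1 *v h) \<bullet> (A1 *v y') = h \<bullet> y'"
        using symmetric_inner[of A1 "\<Sigma>1 *v h" y'] A1
        by (simp add: sym_posdef_def A01 matrix_inv_vector[OF inv\<Sigma>(2)])
      have Ay: "(y - m1) \<bullet> (A1 *v (y - m1)) = y' \<bullet> (A1 *v y') + 2 * r1 * (h \<bullet> y') + r1\<^sup>2 * (h \<bullet> (\<Sigma>1 *v h))"
        unfolding ym using sym
        by (simp add: matrix_vector_right_distrib matrix_vector_mult_scaleR A01 matrix_inv_vector[OF inv\<Sigma>(2)]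
            inner_add_left inner_add_right inner_commute power2_eq_square algebra_simps)
      have Qy: "y' \<bullet> (matrix_inv Q *v y') = y' \<bullet> (A1 *v y') + r1 * (y' \<bullet> y' - y' \<bullet> (matrix_inv L *v y'))"
        by (simp add: Qi inner_add_right inner_diff_right)
      have "((y - m1) \<bullet> (A1 *v (y - m1)) - y' \<bullet> (matrix_inv Q *v y')) / 2
        = - (r1 * G y) / 2 + (r1 * (h \<bullet> h) / 2 + r1\<^sup>2 * (h \<bullet> (\<Sigma>1 *v h)) / 2)"
      proof -
        have "r1 * G y = r1 * (y' \<bullet> y' - y' \<bullet> (matrix_inv L *v y')) - 2 * r1 * (h \<bullet> y') + r1 * (h \<bullet> h)"
          by (simp add: G_def y'_def[symmetric] algebra_simps)
        then show ?thesis unfolding Ay Qy by (simp add: field_simps)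
      qed
      then show ?thesis
        unfolding A01(2)[symmetric] y'_def using pos by (simp add: c1_def r field_simps)
    qed
    then show ?thesis unfolding q mu gaussian_density_ratio[OF Qpd posdef(2), of v m1] by simp
  qed

  \<comment> \<open>The coupling, its cost, and the value of \<open>A\<close>\<close>
  interpret p: prob_space p unfolding p by (rule prob_space_gaussian[OF Ppd])
  interpret q: prob_space q unfolding q by (rule prob_space_gaussian[OF Qpd])
  interpret \<mu>0: prob_space \<mu>0 unfolding mu by (rule prob_space_gaussian[OF posdef(1)])
  interpret \<mu>1: prob_space \<mu>1 unfolding mu by (rule prob_space_gaussian[OF posdef(2)])
  have sets [simp, measurable_cong]: "sets p = sets borel" "sets q = sets borel"
    "sets \<mu>0 = sets borel" "sets \<mu>1 = sets borel" by (simp_all add: p q mu)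
  have intF: "integrable p F"
    using gaussian_integrable_quadratic(1)[OF Ppd, of u u "mat 1"]
      gaussian_integrable_quadratic(1)[OF Ppd, of u u L] gaussian_integrable_quadratic(2)[OF Ppd, of u h u]
    unfolding F_def[abs_def] p by simp
  have intG: "integrable q G"
    using gaussian_integrable_quadratic(1)[OF Qpd, of v v "mat 1"] q.integrable_const[of "h \<bullet> h"]
      gaussian_integrable_quadratic(1)[OF Qpd, of v v "matrix_inv L"] gaussian_integrable_quadratic(2)[OF Qpd, of v h v]
    unfolding G_def[abs_def] q by simp
  have T2: "(\<lambda>x. (x, T x)) \<in> borel \<rightarrow>\<^sub>M borel" by (rule borel_measurable_Pair) auto
  have \<pi>_def: "\<pi> = distr p borel (\<lambda>x. (x, T x))" by (simp add: coupling T_def)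
  have sets\<pi> [simp, measurable_cong]: "sets \<pi> = sets borel" by (simp add: \<pi>_def)
  note [measurable] = fst_snd_measurable_borel T2
  have \<pi>0: "marginal0 \<pi> = p"
    unfolding marginal0_def \<pi>_def by (subst distr_distr) (auto simp: comp_def distr_id2)
  have "marginal1 \<pi> = distr p borel T"
    unfolding marginal1_def \<pi>_def by (subst distr_distr) (auto simp: comp_def)
  then have \<pi>1: "marginal1 \<pi> = q"
    using gaussian_distr_affine[OF Ppd invL, of u v] by (simp add: p q Q symL T_def[abs_def])
  have "prob_space \<pi>" unfolding \<pi>_def by (rule p.prob_space_distr) simp
  then have \<pi>_fin: "\<pi> \<in> finite_borel_measures"
    by (simp add: finite_borel_measures_def prob_space.finite_measure)
  note M\<pi> = finite_borel_measures_marginals[OF \<pi>_fin, unfolded \<pi>0 \<pi>1]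
  have AE\<pi>: "AE z in \<pi>. F (fst z) + G (snd z) = (norm (fst z - snd z))\<^sup>2"
    unfolding FG_eq \<pi>_def by (subst AE_distr_iff) auto
  \<comment> \<open>Almost everywhere on the coupling the cost is a sum of integrable potentials and
    inherits their integrability.\<close>
  have int\<pi>: "integrable \<pi> (\<lambda>z. (norm (fst z - snd z))\<^sup>2)"
  proof -
    have "integrable \<pi> (\<lambda>z. F (fst z) + G (snd z))" using intF intG by (simp add: M\<pi>)
    then show ?thesis using AE\<pi> quad_cost_measurable
      by (subst (asm) integrable_cong_AE) (auto simp: measurable_cong_sets[OF sets\<pi> refl])
  qed
  have meas: "F \<in> borel_measurable borel" "G \<in> borel_measurable borel" by auto
  have cost: "(\<integral>x. F x \<partial>p) + (\<integral>y. G y \<partial>q) = (\<integral>z. (norm (fst z - snd z))\<^sup>2 \<partial>\<pi>)"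
    using quad_cost_ge_potentials(2)[OF \<pi>_fin int\<pi> meas FG_le] intF intG AE\<pi> unfolding \<pi>0 \<pi>1 by blast
  have W2: "(W2 p q)\<^sup>2 = (\<integral>x. F x \<partial>p) + (\<integral>y. G y \<partial>q)"
    unfolding cost using \<pi>_fin \<pi>0 \<pi>1 int\<pi> meas FG_le intF intG AE\<pi>
    by (intro W2_squared_eq_potentials[where f = F and g = G]) (auto simp: couplings_def)
  \<comment> \<open>\<open>p\<close> and \<open>\<mu>0\<close> both have mass one, so for the
    potential \<open>F x - \<tau>0 * c0\<close> the dual value is zero and the divergence is read
    off from the integral of \<open>F\<close>.\<close>
  have KLp: "\<tau>0 * enn2real (gen_KL p \<mu>0) = \<tau>0 * c0 - (\<integral>x. F x \<partial>p)"
  proof -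
    have "(\<integral>x. exp (- (F x - \<tau>0 * c0) / \<tau>0) \<partial>\<mu>0) = measure p (space \<mu>0)"
      by (rule finite_measure_density_integrable(2)[of \<mu>0 "\<lambda>x. exp (- (F x - \<tau>0 * c0) / \<tau>0)",
          folded p_dens]) (auto simp: p.finite_measure_axioms)
    also have "space \<mu>0 = space p" by (simp add: p mu)
    finally have "(\<integral>x. exp (- (F x - \<tau>0 * c0) / \<tau>0) \<partial>\<mu>0) = 1" by (simp only: p.prob_space)
    then have "\<tau>0 * enn2real (gen_KL p \<mu>0) + (\<integral>x. F x - \<tau>0 * c0 \<partial>p) = 0"
      using gen_KL_gap_attained(2)[OF \<mu>0.finite_measure_axioms pos(3) _ p_dens p.finite_measure_axioms] intF
      by (simp add: \<mu>0.prob_space)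
    then show ?thesis using intF by (simp add: p.prob_space)
  qed
  have KLq: "\<tau>1 * enn2real (gen_KL q \<mu>1) = \<tau>1 * c1 - (\<integral>y. G y \<partial>q)"
  proof -
    have "(\<integral>x. exp (- (G x - \<tau>1 * c1) / \<tau>1) \<partial>\<mu>1) = measure q (space \<mu>1)"
      by (rule finite_measure_density_integrable(2)[of \<mu>1 "\<lambda>x. exp (- (G x - \<tau>1 * c1) / \<tau>1)",
          folded q_dens]) (auto simp: q.finite_measure_axioms)
    also have "space \<mu>1 = space q" by (simp add: q mu)
    finally have "(\<integral>x. exp (- (G x - \<tau>1 * c1) / \<tau>1) \<partial>\<mu>1) = 1" by (simp only: q.prob_space)
    then have "\<tau>1 * enn2real (gen_KL q \<mu>1) + (\<integral>x. G x - \<tau>1 * c1 \<partial>q) = 0"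
      using gen_KL_gap_attained(2)[OF \<mu>1.finite_measure_axioms pos(4) _ q_dens q.finite_measure_axioms] intG
      by (simp add: \<mu>1.prob_space)
    then show ?thesis using intG by (simp add: q.prob_space)
  qed
  have A_eq: "A = \<tau>0 * c0 + \<tau>1 * c1" by (simp add: A W2 KLp KLq)

  \<comment> \<open>The mass \<open>M\<close> and the potentials of the unbalanced problem\<close>
  have M0: "M > 0" using pos by (simp add: M)
  have "ln M = \<tau>0 / (\<tau>0 + \<tau>1) * ln a + \<tau>1 / (\<tau>0 + \<tau>1) * ln b - A / (\<tau>0 + \<tau>1)"
    using pos by (simp add: M ln_mult ln_powr)
  also have "\<dots> = (\<tau>0 * ln a + \<tau>1 * ln b - A) / (\<tau>0 + \<tau>1)"
    by (simp add: add_divide_distrib diff_divide_distrib)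
  finally have "(\<tau>0 + \<tau>1) * ln M = \<tau>0 * ln a + \<tau>1 * ln b - A"
    using pos by (simp add: nonzero_eq_divide_eq mult.commute)
  \<comment> \<open>The exponents of \<open>a\<close>, \<open>b\<close> and \<open>exp\<close> in
    \<open>M\<close> are chosen for this identity, which makes the shifts in \<open>\<phi>\<close>
    and \<open>\<psi>\<close> below cancel in the sum.\<close>
  then have lnM: "\<tau>0 * ln (M / a) + \<tau>1 * ln (M / b) = - A"
    using pos M0 by (simp add: ln_div algebra_simps)
  \<comment> \<open>Passing from \<open>p\<close> and \<open>\<mu>0\<close> to \<open>M\<close>
    times \<open>p\<close> and \<open>\<alpha>\<close> multiplies the density by
    \<open>M / a\<close>, whose logarithm is absorbed here.\<close>
  define \<phi> where "\<phi> x = F x - \<tau>0 * c0 - \<tau>0 * ln (M / a)" for x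
  define \<psi> where "\<psi> y = G y - \<tau>1 * c1 - \<tau>1 * ln (M / b)" for y
  have \<phi>\<psi>: "\<phi> x + \<psi> y = F x + G y" for x y
    using lnM A_eq by (simp add: \<phi>_def \<psi>_def)
  have meas\<phi> [measurable]: "\<phi> \<in> borel_measurable borel" "\<psi> \<in> borel_measurable borel"
    unfolding \<phi>_def \<psi>_def by measurable
  have le: "\<phi> x + \<psi> y \<le> (norm (x - y))\<^sup>2" for x y by (simp add: \<phi>\<psi> FG_le)

  \<comment> \<open>Marginals of \<open>\<gamma>\<close> and complementary slackness\<close>
  have \<gamma>d: "\<gamma> = density \<pi> (\<lambda>_. ennreal M)" by (simp add: gamma scale_measure_eq_density)
  have \<gamma>s: "sets \<gamma> = sets borel" by (simp add: \<gamma>d)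
  have \<gamma>: "\<gamma> \<in> finite_borel_measures"
    using \<open>prob_space \<pi>\<close> unfolding finite_borel_measures_def gamma
    by (auto intro!: finite_measureI simp: space_scale_measure prob_space.emeasure_space_1)
  have \<gamma>0: "marginal0 \<gamma> = density p (\<lambda>_. ennreal M)"
    unfolding marginal0_def \<gamma>d by (subst density_distr[symmetric]) (auto simp: \<pi>0[symmetric] marginal0_def)
  have \<gamma>1: "marginal1 \<gamma> = density q (\<lambda>_. ennreal M)"
    unfolding marginal1_def \<gamma>d by (subst density_distr[symmetric]) (auto simp: \<pi>1[symmetric] marginal1_def)
  have \<alpha>s: "sets \<alpha> = sets borel" "finite_measure \<alpha>" and \<beta>s: "sets \<beta> = sets borel" "finite_measure \<beta>"
    by (auto intro!: finite_measureI simp: alpha beta space_scale_measure \<mu>0.emeasure_space_1 \<mu>1.emeasure_space_1)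
  have e0: "ennreal a * ennreal (exp (- \<phi> x / \<tau>0)) = ennreal (exp (- (F x - \<tau>0 * c0) / \<tau>0)) * ennreal M" for x
  proof -
    have "- \<phi> x / \<tau>0 = - (F x - \<tau>0 * c0) / \<tau>0 + ln (M / a)" using pos by (simp add: \<phi>_def field_simps)
    then have "a * exp (- \<phi> x / \<tau>0) = exp (- (F x - \<tau>0 * c0) / \<tau>0) * M"
      using pos M0 by (simp only: exp_add exp_ln divide_pos_pos) simp
    then show ?thesis using pos M0 by (simp only: ennreal_mult[symmetric] exp_ge_zero less_imp_le)
  qed
  have e1: "ennreal b * ennreal (exp (- \<psi> x / \<tau>1)) = ennreal (exp (- (G x - \<tau>1 * c1) / \<tau>1)) * ennreal M" for x
  proof -
    have "- \<psi> x / \<tau>1 = - (G x - \<tau>1 * c1) / \<tau>1 + ln (M / b)" using pos by (simp add: \<psi>_def field_simps)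
    then have "b * exp (- \<psi> x / \<tau>1) = exp (- (G x - \<tau>1 * c1) / \<tau>1) * M"
      using pos M0 by (simp only: exp_add exp_ln divide_pos_pos) simp
    then show ?thesis using pos M0 by (simp only: ennreal_mult[symmetric] exp_ge_zero less_imp_le)
  qed
  have marg0: "marginal0 \<gamma> = density \<alpha> (\<lambda>x. ennreal (exp (- \<phi> x / \<tau>0)))"
    unfolding \<gamma>0 alpha scale_measure_eq_density p_dens
    by (subst (1 2) density_density_eq; (simp only: e0)?; measurable)
  have marg1: "marginal1 \<gamma> = density \<beta> (\<lambda>y. ennreal (exp (- \<psi> y / \<tau>1)))"
    unfolding \<gamma>1 beta scale_measure_eq_density q_dens
    by (subst (1 2) density_density_eq; (simp only: e1)?; measurable)
  have int\<phi>: "integrable (marginal0 \<gamma>) \<phi>" "integrable (marginal1 \<gamma>) \<psi>"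
    unfolding \<gamma>0 \<gamma>1 using M0 intF intG
    by (auto simp: integrable_density \<phi>_def[abs_def] \<psi>_def[abs_def])
  have int\<gamma>: "integrable \<gamma> (\<lambda>z. (norm (fst z - snd z))\<^sup>2)"
    unfolding \<gamma>d using M0 int\<pi> quad_cost_measurable
    by (subst integrable_density) (auto simp: measurable_cong_sets[OF sets\<pi> refl])
  have AE\<gamma>: "AE z in \<gamma>. \<phi> (fst z) + \<psi> (snd z) = (norm (fst z - snd z))\<^sup>2"
    unfolding \<phi>\<psi> \<gamma>d using AE\<pi> by (subst AE_density) auto
  have slack: "KL_complementary_slackness \<tau>0 \<tau>1 \<alpha> \<beta> \<gamma>"
    unfolding KL_complementary_slackness_def
    using meas\<phi> le marg0 marg1 AE\<gamma> by (intro exI[of _ \<phi>] exI[of _ \<psi>]) (auto simp: case_prod_beta)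

  \<comment> \<open>Minimality and uniqueness\<close>
  note att = unbalanced_objective_attained[OF \<alpha>s(2,1) \<beta>s(2,1) pos(3,4) meas\<phi> le \<gamma> marg0 marg1 int\<phi> int\<gamma> AE\<gamma>]
  have ints: "integrable \<alpha> (\<lambda>x. exp (- \<phi> x / \<tau>0))" "integrable \<beta> (\<lambda>y. exp (- \<psi> y / \<tau>1))"
    using finite_measure_density_integrable(1)[of \<alpha> "\<lambda>x. exp (- \<phi> x / \<tau>0)"] marg0
      finite_measure_density_integrable(1)[of \<beta> "\<lambda>y. exp (- \<psi> y / \<tau>1)"] marg1
      finite_borel_measures_marginals(1,2)[OF \<gamma>] meas\<phi>
    by (simp_all add: measurable_cong_sets[OF \<alpha>s(1) refl] measurable_cong_sets[OF \<beta>s(1) refl])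
  note lower = unbalanced_objective_lower_bound[OF \<alpha>s(2,1) \<beta>s(2,1) pos(3,4) meas\<phi> le ints]
  let ?obj = "unbalanced_objective \<tau>0 \<tau>1 \<alpha> \<beta>"
  have min: "?obj \<gamma> \<le> ?obj \<gamma>'" if "\<gamma>' \<in> finite_borel_measures" for \<gamma>'
  proof (cases "?obj \<gamma>' < \<infinity>")
    case True
    then show ?thesis using lower(1)[OF that] att(1) by simp
  qed (simp add: less_top[symmetric])
  \<comment> \<open>The contact set is the graph of \<open>T\<close> independently of the plan, so
    this applies to \<open>\<gamma>\<close> and to any other minimizer alike.\<close>
  have graph: "\<eta> = distr (marginal0 \<eta>) borel (\<lambda>x. (x, T x))"
    if "\<eta> \<in> finite_borel_measures" "AE z in \<eta>. \<phi> (fst z) + \<psi> (snd z) = (norm (fst z - snd z))\<^sup>2" for \<eta>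
    using that unfolding \<phi>\<psi> FG_eq by (intro measure_on_graph_eq) (auto simp: finite_borel_measures_def)
  have "\<exists>!\<gamma>'. is_arg_min ?obj (\<lambda>\<eta>. \<eta> \<in> finite_borel_measures) \<gamma>'"
  proof (rule ex1I[of _ \<gamma>])
    show "is_arg_min ?obj (\<lambda>\<eta>. \<eta> \<in> finite_borel_measures) \<gamma>"
      using \<gamma> min by (auto simp: is_arg_min_def not_less)
    fix \<gamma>' assume \<gamma>': "is_arg_min ?obj (\<lambda>\<eta>. \<eta> \<in> finite_borel_measures) \<gamma>'"
    then have fbm: "\<gamma>' \<in> finite_borel_measures" and "?obj \<gamma>' = ?obj \<gamma>"
      using \<gamma> min by (auto simp: is_arg_min_def not_less intro: antisym)
    \<comment> \<open>The equality case, with the potentials of \<open>\<gamma>\<close>, applies to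
      the second minimizer; both plans are then images of the same marginal under the same
      map.\<close>
    with lower(2)[OF fbm] att have "marginal0 \<gamma>' = marginal0 \<gamma>"
      and "AE z in \<gamma>'. \<phi> (fst z) + \<psi> (snd z) = (norm (fst z - snd z))\<^sup>2"
      unfolding marg0 by simp_all
    then show "\<gamma>' = \<gamma>" using graph[OF fbm] graph[OF \<gamma> AE\<gamma>] by simp
  qed
  with slack show ?thesis ..
qed

end
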